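(* Let $\Lambda_c$ be the conifold algebra and let $\mathbb{C}[x,y,z]\subset\Lambda_c$ be the central polynomial subalgebra generated by $x=X^2$, $y=Y^2$, $z=\frac12(XY+YX)$. Intersecting two-sided prime ideals of $\Lambda_c$ with $\mathbb{C}[x,y,z]$ determines a continuous map $$\phi:\mathrm{spec}\,\Lambda_c\longrightarrow\mathbb{A}^3=\mathrm{spec}\,\mathbb{C}[x,y,z]$$ with the following fiber information, for $\mathfrak{n}$ a maximal ideal of $\mathbb{C}[x,y,z]$ (a closed point of $\mathbb{A}^3$): 1. If $\mathfrak{n}\notin\mathbb{V}(xy-z^2)$, then $\phi^{-1}(\mathfrak{n})$ consists of two points. 2. If $(x,y,z)\neq\mathfrak{n}\in\mathbb{V}(xy-z^2)$, then $\phi^{-1}(\mathfrak{n})$ consists of one point. 3. If $\mathfrak{n}=(x,y,z)$, then $\phi^{-1}(\mathfrak{n})$ consists of two points.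
   Context: The conifold algebra is $$\Lambda_c=\frac{\mathbb{C}\langle X,Y,Z\rangle}{(Z^2-1,\ XZ+ZX,\ YZ+ZY,\ [X^2,Y],\ [Y^2,X])},\qquad [A,B]=AB-BA.$$ The elements $x=X^2$, $y=Y^2$, $z=\frac12(XY+YX)$ are central and algebraically independent. For a (non-commutative) algebra $\Lambda$, $\mathrm{spec}\,\Lambda$ is the set of two-sided prime ideals $P$ ($a\Lambda b\subset P\Rightarrow a\in P$ or $b\in P$) with the Zariski topology whose open sets are $\mathbb{X}(I)=\{P: I\not\subset P\}$ for two-sided ideals $I$. $\mathbb{V}(f)$ denotes the closed subset of $\mathbb{A}^3$ defined by $f=0$. *)

theory Defs
  imports
    "HOL-Algebra.QuotRing"
    "HOL-Algebra.Generated_Rings"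
    "HOL-Algebra.Algebraic_Closure_Type"
    "HOL-Library.Poly_Mapping"
    "HOL-Library.Product_Plus"
    "HOL-Analysis.Abstract_Topology"
begin

section \<open>The free algebra on three letters\<close>

datatype letter = LX | LY | LZ

datatype word = Word (letters: "letter list")

text \<open>Words form a monoid under concatenation. It is written additively because
  \<^typ>\<open>'m \<Rightarrow>\<^sub>0 'k\<close> carries the monoid algebra structure of an additively written monoid.\<close>

instantiation word :: monoid_add
begin

definition zero_word :: word where "zero_word = Word []"

definition plus_word :: "word \<Rightarrow> word \<Rightarrow> word" where
  "plus_word u v = Word (letters u @ letters v)"

instance
  by standard (simp_all add: zero_word_def plus_word_def)

end

type_synonym free_alg = "word \<Rightarrow>\<^sub>0 complex"

abbreviation FreeAlg :: "free_alg ring" where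
  "FreeAlg \<equiv> ring_of_type_algebra"

definition free_gen :: "letter \<Rightarrow> free_alg" where
  "free_gen l = Poly_Mapping.single (Word [l]) 1"

definition free_scalar :: "complex \<Rightarrow> free_alg" where
  "free_scalar c = Poly_Mapping.single 0 c"

section \<open>The conifold algebra\<close>

definition commutator :: "'a::ring \<Rightarrow> 'a \<Rightarrow> 'a" where
  "commutator a b = a * b - b * a"

definition fX :: free_alg where "fX = free_gen LX"
definition fY :: free_alg where "fY = free_gen LY"
definition fZ :: free_alg where "fZ = free_gen LZ"

definition conifold_relations :: "free_alg set" where
  "conifold_relations =
    {fZ^2 - 1, fX * fZ + fZ * fX, fY * fZ + fZ * fY,
     commutator (fX^2) fY, commutator (fY^2) fX}"

text \<open>\<^const>\<open>ideal\<close>, and hence \<^const>\<open>genideal\<close>, always refers to two-sided ideals,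
  also over non-commutative rings.\<close>

definition conifold_ideal :: "free_alg set" where
  "conifold_ideal = Idl\<^bsub>FreeAlg\<^esub> conifold_relations"

definition Conifold :: "free_alg set ring" where
  "Conifold = FreeAlg Quot conifold_ideal"

definition conifold_class :: "free_alg \<Rightarrow> free_alg set" where
  "conifold_class f = conifold_ideal +>\<^bsub>FreeAlg\<^esub> f"

definition cX :: "free_alg set" where "cX = conifold_class fX"
definition cY :: "free_alg set" where "cY = conifold_class fY"

definition cscalar :: "complex \<Rightarrow> free_alg set" where
  "cscalar c = conifold_class (free_scalar c)"

definition cx :: "free_alg set" where
  "cx = cX [^]\<^bsub>Conifold\<^esub> (2::nat)"
definition cy :: "free_alg set" where
  "cy = cY [^]\<^bsub>Conifold\<^esub> (2::nat)"
definition cz :: "free_alg set" where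
  "cz = cscalar (1/2) \<otimes>\<^bsub>Conifold\<^esub>
     (cX \<otimes>\<^bsub>Conifold\<^esub> cY \<oplus>\<^bsub>Conifold\<^esub> cY \<otimes>\<^bsub>Conifold\<^esub> cX)"

text \<open>The \<open>\<complex>\<close>-subalgebra generated by \<^const>\<open>cx\<close>, \<^const>\<open>cy\<close>, \<^const>\<open>cz\<close>; the scalars are
  listed among the generators because \<^const>\<open>generate_ring\<close> only produces a subring.\<close>

definition Cxyz :: "free_alg set ring" where
  "Cxyz = Conifold \<lparr> carrier := generate_ring Conifold (range cscalar \<union> {cx, cy, cz}) \<rparr>"

section \<open>Polynomials in three variables\<close>

text \<open>\<open>(i, j, k)\<close> is the exponent of the monomial \<open>x\<^sup>i y\<^sup>j z\<^sup>k\<close>.\<close>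

type_synonym poly3 = "(nat \<times> nat \<times> nat) \<Rightarrow>\<^sub>0 complex"

definition eval_xyz :: "poly3 \<Rightarrow> free_alg set" where
  "eval_xyz p =
    finsum Conifold
      (\<lambda>(i, j, k). cscalar (Poly_Mapping.lookup p (i, j, k)) \<otimes>\<^bsub>Conifold\<^esub>
        (cx [^]\<^bsub>Conifold\<^esub> i \<otimes>\<^bsub>Conifold\<^esub> cy [^]\<^bsub>Conifold\<^esub> j \<otimes>\<^bsub>Conifold\<^esub> cz [^]\<^bsub>Conifold\<^esub> k))
      (Poly_Mapping.keys p)"

section \<open>The prime spectrum of a (non-commutative) ring\<close>

text \<open>The library's \<^const>\<open>primeideal\<close> is confined to commutative rings.\<close>

definition nc_primeideal :: "'a set \<Rightarrow> ('a, 'b) ring_scheme \<Rightarrow> bool" where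
  "nc_primeideal P R \<longleftrightarrow> ideal P R \<and> P \<noteq> carrier R \<and>
    (\<forall>a\<in>carrier R. \<forall>b\<in>carrier R.
      (\<forall>r\<in>carrier R. a \<otimes>\<^bsub>R\<^esub> r \<otimes>\<^bsub>R\<^esub> b \<in> P) \<longrightarrow> a \<in> P \<or> b \<in> P)"

definition nc_spec :: "('a, 'b) ring_scheme \<Rightarrow> 'a set set" where
  "nc_spec R = {P. nc_primeideal P R}"

definition zariski_open :: "('a, 'b) ring_scheme \<Rightarrow> 'a set \<Rightarrow> 'a set set" where
  "zariski_open R I = {P \<in> nc_spec R. \<not> I \<subseteq> P}"

definition zariski :: "('a, 'b) ring_scheme \<Rightarrow> 'a set topology" where
  "zariski R = topology (\<lambda>U. \<exists>I. ideal I R \<and> U = zariski_open R I)"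

definition zariski_closed :: "('a, 'b) ring_scheme \<Rightarrow> 'a \<Rightarrow> 'a set set" where
  "zariski_closed R f = {P \<in> nc_spec R. f \<in> P}"

lemma (in ring) istopology_zariski:
  "istopology (\<lambda>U. \<exists>I. ideal I R \<and> U = zariski_open R I)"
proof -
  have inter: "\<exists>K. ideal K R \<and> zariski_open R I \<inter> zariski_open R J = zariski_open R K"
    if I: "ideal I R" and J: "ideal J R" for I J
  proof (intro exI conjI)
    show "ideal (I \<inter> J) R" by (rule i_intersect[OF I J])
    have "\<not> I \<inter> J \<subseteq> P" if P: "P \<in> nc_spec R" and nI: "\<not> I \<subseteq> P" and nJ: "\<not> J \<subseteq> P" for P
    proof -
      obtain a b where a: "a \<in> I" "a \<notin> P" and b: "b \<in> J" "b \<notin> P" using nI nJ by blast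
      have ac: "a \<in> carrier R" and bc: "b \<in> carrier R"
        using a b ideal.Icarr[OF I] ideal.Icarr[OF J] by auto
      then obtain r where r: "r \<in> carrier R" "a \<otimes> r \<otimes> b \<notin> P"
        using P a b unfolding nc_spec_def nc_primeideal_def by blast
      have "a \<otimes> r \<otimes> b \<in> I"
        using ideal.I_r_closed[OF I] a r(1) bc by blast
      moreover have "a \<otimes> r \<otimes> b \<in> J"
        using ideal.I_l_closed[OF J] b r(1) ac by blast
      ultimately show ?thesis using r by blast
    qed
    then show "zariski_open R I \<inter> zariski_open R J = zariski_open R (I \<inter> J)"
      unfolding zariski_open_def by blast
  qed
  have union: "\<exists>K. ideal K R \<and> \<Union>\<K> = zariski_open R K"
    if opens: "\<forall>U\<in>\<K>. \<exists>I. ideal I R \<and> U = zariski_open R I" for \<K>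
  proof -
    obtain F where F: "\<And>U. U \<in> \<K> \<Longrightarrow> ideal (F U) R \<and> U = zariski_open R (F U)"
      using bchoice[OF opens] by blast
    define S where "S = (\<Union>U\<in>\<K>. F U)"
    have Sc: "S \<subseteq> carrier R"
    proof
      fix s assume "s \<in> S"
      then obtain U where U: "U \<in> \<K>" "s \<in> F U" unfolding S_def by blast
      show "s \<in> carrier R"
        using ideal.Icarr[OF conjunct1[OF F[OF U(1)]] U(2)] .
    qed
    have "Idl S \<subseteq> P \<longleftrightarrow> S \<subseteq> P" if "P \<in> nc_spec R" for P
    proof -
      have P: "ideal P R" using that by (simp add: nc_spec_def nc_primeideal_def)
      show ?thesis
        using genideal_self[OF Sc] genideal_minimal[OF P, of S] by auto
    qed
    then have "zariski_open R (Idl S) = {P \<in> nc_spec R. \<not> S \<subseteq> P}"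
      unfolding zariski_open_def by blast
    also have "\<dots> = (\<Union>U\<in>\<K>. zariski_open R (F U))"
      unfolding zariski_open_def S_def by blast
    also have "\<dots> = \<Union>\<K>" using F by simp
    finally have "\<Union>\<K> = zariski_open R (Idl S)" by (rule sym)
    then show ?thesis using genideal_ideal[OF Sc] by (intro exI conjI)
  qed
  show ?thesis
    unfolding istopology_def
  proof (intro conjI allI impI, goal_cases)
    case (1 U W)
    then show ?case using inter by fastforce
  next
    case (2 \<K>)
    then show ?case by (rule union)
  qed
qed

corollary (in ring) openin_zariski:
  "openin (zariski R) U \<longleftrightarrow> (\<exists>I. ideal I R \<and> U = zariski_open R I)"
  unfolding zariski_def by (simp add: topology_inverse'[OF istopology_zariski])

corollary (in ring) topspace_zariski: "topspace (zariski R) = nc_spec R"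
proof -
  have "nc_spec R = zariski_open R (carrier R)"
    by (auto simp: nc_spec_def nc_primeideal_def zariski_open_def dest: ideal.Icarr)
  then have "openin (zariski R) (nc_spec R)"
    unfolding openin_zariski using oneideal by blast
  moreover have "U \<subseteq> nc_spec R" if "openin (zariski R) U" for U
    using that unfolding openin_zariski zariski_open_def by blast
  ultimately show ?thesis
    unfolding topspace_def by blast
qed

definition restrict_xyz :: "free_alg set set \<Rightarrow> free_alg set set" where
  "restrict_xyz P = P \<inter> carrier Cxyz"

definition restrict_fibre :: "free_alg set set \<Rightarrow> free_alg set set set" where
  "restrict_fibre \<nn> = {P \<in> nc_spec Conifold. restrict_xyz P = \<nn>}"

section \<open>The rings above are rings\<close>

text \<open>The library proves this for commutative rings only.\<close>

lemma ring_ring_of_type_algebra: "ring (ring_of_type_algebra :: 'a::ring_1 ring)"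
proof -
  have "\<exists>y. x + y = 0" for x :: 'a
    by (metis add.right_inverse)
  then show ?thesis
    unfolding ring_of_type_algebra_def
    by unfold_locales (auto simp: algebra_simps Units_def)
qed

lemma ideal_conifold_ideal: "ideal conifold_ideal FreeAlg"
proof -
  have "ring FreeAlg" by (rule ring_ring_of_type_algebra)
  then show ?thesis unfolding conifold_ideal_def
    by (rule ring.genideal_ideal) (simp add: ring_of_type_algebra_def)
qed

lemma ring_Conifold: "ring Conifold"
  unfolding Conifold_def by (rule ideal.quotient_is_ring[OF ideal_conifold_ideal])

lemma conifold_class_closed [simp]: "conifold_class f \<in> carrier Conifold"
  unfolding conifold_class_def Conifold_def FactRing_def A_RCOSETS_def'
  by (auto simp: ring_of_type_algebra_def)

lemma ring_Cxyz: "ring Cxyz"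
proof -
  interpret ring Conifold by (rule ring_Conifold)
  have "range cscalar \<union> {cx, cy, cz} \<subseteq> carrier Conifold"
    by (auto simp: cscalar_def cx_def cy_def cz_def cX_def cY_def)
  then show ?thesis unfolding Cxyz_def by (rule generate_ring_is_ring)
qed

end

theory Submission
  imports Defs "HOL-Computational_Algebra.Fundamental_Theorem_Algebra"
    "HOL-Analysis.Continuum_Not_Denumerable"
begin

text \<open>Put \<open>w = (XY - YX)Z\<close>. It is central and \<open>w\<^sup>2 = 4(z\<^sup>2 - xy)\<close>. So a prime ideal above the point
  \<open>(a, b, c)\<close> contains \<open>w - 2s\<close> for one of the two roots \<open>s\<close> of \<open>s\<^sup>2 = c\<^sup>2 - ab\<close>. Away from the
  origin the choice of \<open>s\<close> determines a \<open>2 \<times> 2\<close> representation, in which \<open>Z = diag(1, -1)\<close> and \<open>X\<close>, \<open>Y\<close>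
  are off-diagonal, and its matrix units lift modulo the prime ideal; hence the prime ideal is the
  kernel of this representation. Above the origin \<open>X\<close> and \<open>Y\<close> lie in the prime ideal, and \<open>Z\<close>
  becomes central with \<open>Z\<^sup>2 = 1\<close>, so \<open>Z = \<plusminus>1\<close>. The maximal ideals of the polynomial ring are
  points by the Nullstellensatz, and the representations separate polynomials in
  \<open>x\<close>, \<open>y\<close>, \<open>z\<close>, which makes these three elements algebraically independent.\<close>

section \<open>Evaluation of monoid algebras\<close>

text \<open>Origin of \<open>w\<close> and \<open>s\<close>: the elements \<open>XY\<close> and
  \<open>YX\<close> commute, with product \<open>xy\<close> and sum \<open>2z\<close>, so both are
  roots of T^2 - 2zT + xy. Up to the factor \<open>Z\<close>, which makes it central,
  \<open>w\<close> is the difference of these roots, and its square is the discriminant. On the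
  quadric the discriminant vanishes, \<open>s\<close> and \<open>-s\<close> coincide, and the two
  primes merge. Origin of the arrows: the products of an arrow of one direction with an arrow of the
  other must be \<open>a\<close>, \<open>c + s\<close>, \<open>c - s\<close>, \<open>b\<close>.
  Arranged as a 2 x 2 matrix they have determinant ab - c^2 + s^2 = 0. Unless (a, b, c) is the
  origin, the matrix is nonzero, hence of rank one, and factors as a column of two arrows times a
  row of two arrows. At the origin it is zero, so all arrows of one direction vanish and the
  representation is reducible; this is why the origin needs its own argument. Obstacle: a prime
  ideal brings no representation with it. All computations therefore take place in the algebra, as
  congruences modulo the ideal, and the representation is recognised only at the end.\<close>

lemma poly_mapping_single_induct [case_names zero single]:
  fixes f :: "'m \<Rightarrow>\<^sub>0 'k::comm_monoid_add"
  assumes "P 0" and "\<And>m c f. P f \<Longrightarrow> P (Poly_Mapping.single m c + f)"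
  shows "P f"
proof (induction f rule: update_induct)
  case const
  show ?case by (rule assms(1))
next
  case (update f a b)
  have "Poly_Mapping.update a b f = Poly_Mapping.single a b + f"
    using update(1) by (intro poly_mapping_eqI)
      (auto simp: lookup_update lookup_add lookup_single in_keys_iff)
  then show ?case using assms(2) update by simp
qed

text \<open>One universal property for words and for exponent triples, with values in numbers,
  matrices or \<open>conif\<close>. Since the target may be non-commutative, scalars are required to
  commute with the values of monomials.\<close>

locale monoid_algebra_eval =
  fixes \<iota> :: "complex \<Rightarrow> 'r::ring_1" and \<chi> :: "'m::monoid_add \<Rightarrow> 'r"
  assumes scalar_add: "\<iota> (c + d) = \<iota> c + \<iota> d"
    and scalar_mult: "\<iota> (c * d) = \<iota> c * \<iota> d"
    and scalar_one: "\<iota> 1 = 1"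
    and mon_zero: "\<chi> 0 = 1"
    and mon_add: "\<chi> (m + n) = \<chi> m * \<chi> n"
    and mon_commute: "\<chi> m * \<iota> c = \<iota> c * \<chi> m"
begin

definition eval :: "('m \<Rightarrow>\<^sub>0 complex) \<Rightarrow> 'r" where
  "eval f = (\<Sum>m\<in>Poly_Mapping.keys f. \<iota> (Poly_Mapping.lookup f m) * \<chi> m)"

lemma scalar_zero: "\<iota> 0 = 0"
  using scalar_add[of 0 0] by simp

lemma eval_superset:
  assumes "finite A" "Poly_Mapping.keys f \<subseteq> A"
  shows "eval f = (\<Sum>m\<in>A. \<iota> (Poly_Mapping.lookup f m) * \<chi> m)"
  unfolding eval_def using assms
  by (intro sum.mono_neutral_left) (auto simp: in_keys_iff scalar_zero)

lemma eval_zero [simp]: "eval 0 = 0"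
  by (simp add: eval_def)

lemma eval_single [simp]: "eval (Poly_Mapping.single m c) = \<iota> c * \<chi> m"
  by (subst eval_superset[of "{m}"]) auto

lemma eval_add: "eval (f + g) = eval f + eval g"
proof -
  let ?A = "Poly_Mapping.keys f \<union> Poly_Mapping.keys g"
  have "Poly_Mapping.keys (f + g) \<subseteq> ?A" by (rule keys_add)
  then show ?thesis
    by (simp add: eval_superset[of ?A] lookup_add scalar_add distrib_right sum.distrib)
qed

lemma eval_single_mult: "eval (Poly_Mapping.single m c * g) = \<iota> c * \<chi> m * eval g"
proof (induction g rule: poly_mapping_single_induct)
  case zero
  show ?case by simp
next
  case (single n d g)
  have "\<chi> m * (\<iota> d * \<chi> n) = \<iota> d * (\<chi> m * \<chi> n)"
    using mon_commute[of m d] by (metis mult.assoc)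
  then show ?case using single
    by (simp add: distrib_left eval_add mult_single scalar_mult mon_add mult.assoc)
qed

lemma eval_mult: "eval (f * g) = eval f * eval g"
  by (induction f rule: poly_mapping_single_induct)
    (simp_all add: distrib_right eval_add eval_single_mult)

lemma eval_one: "eval 1 = 1"
  using eval_single[of 0 1] by (simp add: scalar_one mon_zero)

lemma eval_minus: "eval (f - g) = eval f - eval g"
  using eval_add[of "f - g" g] by simp

end

lemma ring_of_type_algebra_simps [simp]:
  "carrier (ring_of_type_algebra :: 'a::ring_1 ring) = UNIV"
  "monoid.mult (ring_of_type_algebra :: 'a::ring_1 ring) = (*)"
  "monoid.one (ring_of_type_algebra :: 'a::ring_1 ring) = 1"
  "ring.zero (ring_of_type_algebra :: 'a::ring_1 ring) = 0"
  "ring.add (ring_of_type_algebra :: 'a::ring_1 ring) = (+)"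
  by (simp_all add: ring_of_type_algebra_def fun_eq_iff)

lemma ring_of_type_algebra_uminus [simp]:
  "a_inv (ring_of_type_algebra :: 'a::ring_1 ring) f = - f"
proof -
  interpret ring "ring_of_type_algebra :: 'a ring" by (rule ring_ring_of_type_algebra)
  show ?thesis using minus_equality[of "- f" f] by simp
qed

section \<open>Representations of the conifold algebra\<close>

locale conifold_rep =
  fixes \<iota> :: "complex \<Rightarrow> 'r::ring_1" and \<xi> \<eta> \<zeta> :: 'r
  assumes scalar_add: "\<iota> (c + d) = \<iota> c + \<iota> d"
    and scalar_mult: "\<iota> (c * d) = \<iota> c * \<iota> d"
    and scalar_one: "\<iota> 1 = 1"
    and scalar_central: "a * \<iota> c = \<iota> c * a"
    and rels: "\<zeta> * \<zeta> = 1" "\<xi> * \<zeta> + \<zeta> * \<xi> = 0" "\<eta> * \<zeta> + \<zeta> * \<eta> = 0"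
      "\<xi> * \<xi> * \<eta> = \<eta> * (\<xi> * \<xi>)" "\<eta> * \<eta> * \<xi> = \<xi> * (\<eta> * \<eta>)"
begin

definition gen :: "letter \<Rightarrow> 'r" where
  "gen l = (case l of LX \<Rightarrow> \<xi> | LY \<Rightarrow> \<eta> | LZ \<Rightarrow> \<zeta>)"

sublocale free: monoid_algebra_eval \<iota> "\<lambda>w. prod_list (map gen (letters w))"
  by standard (rule scalar_add scalar_mult scalar_one scalar_central
      | simp add: zero_word_def plus_word_def)+

lemma free_gen: "free.eval (free_gen l) = gen l"
  by (simp add: free_gen_def scalar_one)

lemma free_gens: "free.eval fX = \<xi>" "free.eval fY = \<eta>" "free.eval fZ = \<zeta>"
  by (simp_all add: fX_def fY_def fZ_def free_gen gen_def)

lemma free_scalar: "free.eval (free_scalar c) = \<iota> c"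
  by (simp add: free_scalar_def zero_word_def)

lemma kernel_ideal: "ideal {f. free.eval f = 0} FreeAlg"
proof -
  have "ring_hom_ring FreeAlg (ring_of_type_algebra :: 'r ring) free.eval"
    by (rule ring_hom_ringI2[OF ring_ring_of_type_algebra ring_ring_of_type_algebra])
      (simp add: ring_hom_def free.eval_add free.eval_mult free.eval_one)
  from ring_hom_ring.kernel_is_ideal[OF this] show ?thesis
    by (simp add: a_kernel_def')
qed

lemma conifold_ideal_kernel: "conifold_ideal \<subseteq> {f. free.eval f = 0}"
proof -
  interpret ring FreeAlg by (rule ring_ring_of_type_algebra)
  have "conifold_relations \<subseteq> {f. free.eval f = 0}"
    using rels unfolding mult.assoc
    by (simp add: conifold_relations_def commutator_def power2_eq_square free_gens
        free.eval_mult free.eval_minus free.eval_add free.eval_one mult.assoc)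
  then show ?thesis
    unfolding conifold_ideal_def by (rule genideal_minimal[OF kernel_ideal])
qed

end

text \<open>With explicit entries the ring laws follow by case analysis, and matrix products compute
  by rewriting.\<close>

datatype mat2 = Mat2 complex complex complex complex

instantiation mat2 :: ring_1
begin

definition zero_mat2 where "0 = Mat2 0 0 0 0"
definition one_mat2 where "1 = Mat2 1 0 0 1"
fun plus_mat2 where "Mat2 a b c d + Mat2 a' b' c' d' = Mat2 (a + a') (b + b') (c + c') (d + d')"
fun minus_mat2 where "Mat2 a b c d - Mat2 a' b' c' d' = Mat2 (a - a') (b - b') (c - c') (d - d')"
fun uminus_mat2 where "- Mat2 a b c d = Mat2 (- a) (- b) (- c) (- d)"
fun times_mat2 where "Mat2 a b c d * Mat2 a' b' c' d' =
  Mat2 (a * a' + b * c') (a * b' + b * d') (c * a' + d * c') (c * b' + d * d')"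

instance
proof
  fix a b c :: mat2
  show "a + b + c = a + (b + c)" "a + b = b + a" "0 + a = a" "- a + a = 0" "a - b = a + - b"
    "a * b * c = a * (b * c)" "1 * a = a" "a * 1 = a" "(a + b) * c = a * c + b * c"
    "a * (b + c) = a * b + a * c" "(0::mat2) \<noteq> 1"
    by (cases a; cases b; cases c; simp add: zero_mat2_def one_mat2_def algebra_simps)+
qed

end

definition mat2_scalar :: "complex \<Rightarrow> mat2" where "mat2_scalar c = Mat2 c 0 0 c"

text \<open>A representation of the conifold quiver: \<open>Z\<close> splits the space into two lines, between
  which \<open>X\<close> and \<open>Y\<close> act by the arrows \<open>x\<^sub>1\<close>, \<open>y\<^sub>1\<close> in one
  direction and \<open>x\<^sub>2\<close>, \<open>y\<^sub>2\<close> in the other.\<close>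

locale quiver_rep =
  fixes x\<^sub>1 x\<^sub>2 y\<^sub>1 y\<^sub>2 :: complex
begin

sublocale conifold_rep mat2_scalar "Mat2 0 x\<^sub>1 x\<^sub>2 0" "Mat2 0 y\<^sub>1 y\<^sub>2 0" "Mat2 1 0 0 (-1)"
proof
  fix a :: mat2 and c
  show "a * mat2_scalar c = mat2_scalar c * a"
    by (cases a) (simp add: mat2_scalar_def algebra_simps)
qed (simp_all add: mat2_scalar_def one_mat2_def zero_mat2_def algebra_simps)

end

text \<open>The one-dimensional representations that kill \<open>X\<close> and \<open>Y\<close>;
  their kernels will be the primes above the origin.\<close>

locale sign_rep =
  fixes \<epsilon> :: complex
  assumes sign: "\<epsilon> * \<epsilon> = 1"
begin

sublocale conifold_rep "\<lambda>c. c" 0 0 \<epsilon>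
  by standard (simp_all add: sign)

end

lemma ring_of_type_algebra_minus [simp]:
  "f \<ominus>\<^bsub>(ring_of_type_algebra :: 'a::ring_1 ring)\<^esub> g = f - g"
  by (simp add: a_minus_def)

section \<open>The conifold algebra as a type\<close>

text \<open>As a type of class \<open>ring_1\<close> the algebra admits ordinary ring rewriting for
  the computations with words. \<open>Rep_conif\<close> carries the results back to cosets.\<close>

typedef conif = "carrier Conifold"
  using conifold_class_closed by blast

interpretation Conifold: ring Conifold by (rule ring_Conifold)

lemma Rep_conif_closed [simp]: "Rep_conif a \<in> carrier Conifold"
  by (rule Rep_conif)

lemma conifold_class_eq_iff: "conifold_class f = conifold_class g \<longleftrightarrow> f - g \<in> conifold_ideal"
proof -
  interpret ideal conifold_ideal FreeAlg by (rule ideal_conifold_ideal)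
  have "conifold_class f = conifold_class g \<longleftrightarrow> f \<in> conifold_ideal +>\<^bsub>FreeAlg\<^esub> g"
    unfolding conifold_class_def
    using a_rcos_self[of f] a_repr_independence[of f conifold_ideal g, OF _ _ is_additive_subgroup[THEN additive_subgroup.a_subgroup]] by auto
  also have "\<dots> \<longleftrightarrow> f - g \<in> conifold_ideal"
    using a_rcos_module_minus[OF ring_ring_of_type_algebra, of g f] by simp
  finally show ?thesis .
qed

lemma conifold_class_ring_hom: "conifold_class \<in> ring_hom FreeAlg Conifold"
  unfolding conifold_class_def Conifold_def
  by (rule ideal.rcos_ring_hom[OF ideal_conifold_ideal])

lemma conifold_class_hom:
  "conifold_class (f + g) = conifold_class f \<oplus>\<^bsub>Conifold\<^esub> conifold_class g"
  "conifold_class (f * g) = conifold_class f \<otimes>\<^bsub>Conifold\<^esub> conifold_class g"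
  "conifold_class 1 = \<one>\<^bsub>Conifold\<^esub>"
  "conifold_class 0 = \<zero>\<^bsub>Conifold\<^esub>"
  using ring_hom_add[OF conifold_class_ring_hom, of f g]
    ring_hom_mult[OF conifold_class_ring_hom, of f g] ring_hom_one[OF conifold_class_ring_hom]
    ring_hom_zero[OF conifold_class_ring_hom ring_ring_of_type_algebra ring_Conifold]
  by simp_all

lemma conifold_class_surj: "A \<in> carrier Conifold \<Longrightarrow> \<exists>f. A = conifold_class f"
  unfolding conifold_class_def Conifold_def FactRing_def A_RCOSETS_def' by auto

instantiation conif :: ring_1
begin

definition "0 = Abs_conif (\<zero>\<^bsub>Conifold\<^esub>)"
definition "1 = Abs_conif (\<one>\<^bsub>Conifold\<^esub>)"
definition "a + b = Abs_conif (Rep_conif a \<oplus>\<^bsub>Conifold\<^esub> Rep_conif b)"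
definition "a - b = Abs_conif (Rep_conif a \<ominus>\<^bsub>Conifold\<^esub> Rep_conif b)"
definition "- a = Abs_conif (\<ominus>\<^bsub>Conifold\<^esub> Rep_conif a)"
definition "a * b = Abs_conif (Rep_conif a \<otimes>\<^bsub>Conifold\<^esub> Rep_conif b)"

lemma Rep_conif_ops:
  "Rep_conif 0 = \<zero>\<^bsub>Conifold\<^esub>" "Rep_conif 1 = \<one>\<^bsub>Conifold\<^esub>"
  "Rep_conif (a + b) = Rep_conif a \<oplus>\<^bsub>Conifold\<^esub> Rep_conif b"
  "Rep_conif (a - b) = Rep_conif a \<ominus>\<^bsub>Conifold\<^esub> Rep_conif b"
  "Rep_conif (- a) = \<ominus>\<^bsub>Conifold\<^esub> Rep_conif a"
  "Rep_conif (a * b) = Rep_conif a \<otimes>\<^bsub>Conifold\<^esub> Rep_conif b"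
  by (simp_all add: zero_conif_def one_conif_def plus_conif_def minus_conif_def
      uminus_conif_def times_conif_def Abs_conif_inverse)

instance
proof
  \<comment> \<open>That the relations do not collapse the algebra needs some representation on a
    nonzero space; the one with all arrows zero is enough.\<close>
  interpret quiver_rep 0 0 0 0 .
  have "\<one>\<^bsub>Conifold\<^esub> \<noteq> \<zero>\<^bsub>Conifold\<^esub>"
  proof
    assume "\<one>\<^bsub>Conifold\<^esub> = \<zero>\<^bsub>Conifold\<^esub>"
    then have "conifold_class 1 = conifold_class 0"
      by (simp add: conifold_class_hom)
    then have "1 \<in> conifold_ideal" by (simp add: conifold_class_eq_iff)
    then show False using conifold_ideal_kernel free.eval_one by auto
  qed
  then show "(0::conif) \<noteq> 1" by (metis Rep_conif_ops(1,2))
qed (simp_all add: Rep_conif_inject[symmetric] Rep_conif_ops Conifold.ring_simprules)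

end

definition conif_of :: "free_alg \<Rightarrow> conif" where
  "conif_of f = Abs_conif (conifold_class f)"

lemma Rep_conif_of: "Rep_conif (conif_of f) = conifold_class f"
  by (simp add: conif_of_def Abs_conif_inverse)

lemma conif_of_hom:
  "conif_of (f + g) = conif_of f + conif_of g"
  "conif_of (f * g) = conif_of f * conif_of g"
  "conif_of 1 = 1" "conif_of 0 = 0"
  by (simp_all add: Rep_conif_inject[symmetric] Rep_conif_of Rep_conif_ops conifold_class_hom)

lemma conif_of_eq_iff: "conif_of f = conif_of g \<longleftrightarrow> f - g \<in> conifold_ideal"
  by (simp add: Rep_conif_inject[symmetric] Rep_conif_of conifold_class_eq_iff)

lemma conif_of_minus: "conif_of (f - g) = conif_of f - conif_of g"
  using conif_of_hom(1)[of "f - g" g] by simp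

lemma conif_of_surj: "\<exists>f. a = conif_of f"
  using conifold_class_surj[of "Rep_conif a"] by (metis Rep_conif_closed Rep_conif_inject Rep_conif_of)

definition gX :: conif where "gX = conif_of fX"
definition gY :: conif where "gY = conif_of fY"
definition gZ :: conif where "gZ = conif_of fZ"
definition sc :: "complex \<Rightarrow> conif" where "sc c = conif_of (free_scalar c)"

lemma sc_add: "sc (c + d) = sc c + sc d"
  and sc_mult: "sc (c * d) = sc c * sc d"
  and sc_one [simp]: "sc 1 = 1"
  and sc_zero [simp]: "sc 0 = 0"
  by (simp_all add: sc_def free_scalar_def single_add mult_single conif_of_hom[symmetric])

lemma sc_minus: "sc (- c) = - sc c"
  using sc_add[of c "- c"] by (simp add: eq_neg_iff_add_eq_0 add.commute)

lemma sc_diff: "sc (c - d) = sc c - sc d"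
  using sc_add[of "c - d" d] by simp

lemma sc_two: "sc 2 = 2"
  using sc_add[of 1 1] by simp

lemma free_scalar_commute: "f * free_scalar c = free_scalar c * f"
  by (induction f rule: poly_mapping_single_induct)
    (simp_all add: free_scalar_def distrib_left distrib_right mult_single mult.commute)

lemma sc_commute: "a * sc c = sc c * a"
  using conif_of_surj[of a] by (auto simp: sc_def conif_of_hom[symmetric] free_scalar_commute)

lemma sc_left_commute: "a * (sc c * b) = sc c * (a * b)"
  by (metis mult.assoc sc_commute)

text \<open>The scalars are moved past the generators only: as a rewrite rule for arbitrary elements,
  \<open>sc_left_commute\<close> would loop on a product of two scalars.\<close>

lemmas gen_sc = sc_commute[of gX] sc_commute[of gY] sc_commute[of gZ]
  sc_left_commute[of gX] sc_left_commute[of gY] sc_left_commute[of gZ]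

lemma sc_sc: "sc c * (sc d * a) = sc (c * d) * a"
  by (simp add: sc_mult mult.assoc)

lemma sc_cancel: "c \<noteq> 0 \<Longrightarrow> sc (inverse c) * (sc c * a) = a"
  by (simp add: sc_sc)

lemma conifold_relations_in_ideal: "conifold_relations \<subseteq> conifold_ideal"
proof -
  interpret ring FreeAlg by (rule ring_ring_of_type_algebra)
  show ?thesis unfolding conifold_ideal_def by (rule genideal_self) simp
qed

lemma conif_of_relation: "f \<in> conifold_relations \<Longrightarrow> conif_of f = 0"
  using conif_of_eq_iff[of f 0] conifold_relations_in_ideal by (auto simp: conif_of_hom)

lemma gen_rels:
  "gZ * gZ = 1" "gX * gZ = - (gZ * gX)" "gY * gZ = - (gZ * gY)"
  "gX * gX * gY = gY * (gX * gX)" "gY * gY * gX = gX * (gY * gY)"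
  using conif_of_relation[of "fZ^2 - 1"] conif_of_relation[of "fX * fZ + fZ * fX"]
    conif_of_relation[of "fY * fZ + fZ * fY"] conif_of_relation[of "commutator (fX^2) fY"]
    conif_of_relation[of "commutator (fY^2) fX"]
  by (simp_all add: conifold_relations_def conif_of_hom conif_of_minus power2_eq_square
      commutator_def gX_def gY_def gZ_def eq_neg_iff_add_eq_0)

text \<open>Words grow by letters appended on the right, starting from a scalar. Congruences and
  memberships modulo an ideal are thus checked one letter at a time.\<close>

lemma conif_induct [case_names sc add X Y Z]:
  assumes sc: "\<And>c. P (sc c)" and add: "\<And>a b. P a \<Longrightarrow> P b \<Longrightarrow> P (a + b)"
    and X: "\<And>a. P a \<Longrightarrow> P (a * gX)" and Y: "\<And>a. P a \<Longrightarrow> P (a * gY)"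
    and Z: "\<And>a. P a \<Longrightarrow> P (a * gZ)"
  shows "P a"
proof -
  have word: "P (conif_of (Poly_Mapping.single (Word w) c))" for w c
  proof (induction w rule: rev_induct)
    case Nil
    show ?case using sc[of c] by (simp add: sc_def free_scalar_def zero_word_def)
  next
    case (snoc l w)
    have "Poly_Mapping.single (Word (w @ [l])) c = Poly_Mapping.single (Word w) c * free_gen l"
      by (simp add: free_gen_def mult_single plus_word_def)
    moreover have "P (conif_of (Poly_Mapping.single (Word w) c) * conif_of (free_gen l))"
      using X[OF snoc] Y[OF snoc] Z[OF snoc]
      by (cases l) (simp_all add: gX_def gY_def gZ_def fX_def fY_def fZ_def)
    ultimately show ?case by (simp add: conif_of_hom)
  qed
  obtain f where "a = conif_of f" using conif_of_surj by blast
  moreover have "P (conif_of f)"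
  proof (induction f rule: poly_mapping_single_induct)
    case zero
    show ?case using sc[of 0] by (simp add: conif_of_hom)
  next
    case (single w c f)
    then show ?case using add word[of "letters w" c] by (simp add: conif_of_hom)
  qed
  ultimately show ?thesis by simp
qed

lemma central_if_commutes_gens:
  assumes "u * gX = gX * u" "u * gY = gY * u" "u * gZ = gZ * u"
  shows "u * a = a * u"
proof (induction a rule: conif_induct)
  case (sc c)
  show ?case by (rule sc_commute)
next
  case (add a b)
  then show ?case by (simp add: algebra_simps)
qed (metis assms mult.assoc)+

context conifold_rep
begin

text \<open>The factorisation of \<open>free.eval\<close> through the quotient. The chosen
  representative is immaterial because \<open>conifold_ideal\<close> lies in the kernel, see
  \<open>lift_conif_of\<close>.\<close>

definition lift :: "conif \<Rightarrow> 'r" where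
  "lift a = free.eval (SOME f. a = conif_of f)"

lemma lift_conif_of: "lift (conif_of f) = free.eval f"
proof -
  let ?g = "SOME g. conif_of f = conif_of g"
  have "conif_of f = conif_of ?g" by (rule someI[of _ f]) simp
  then have "free.eval (f - ?g) = 0"
    using conifold_ideal_kernel by (auto simp: conif_of_eq_iff)
  then show ?thesis by (simp add: lift_def free.eval_minus)
qed

lemma lift_add: "lift (a + b) = lift a + lift b"
  and lift_mult: "lift (a * b) = lift a * lift b"
  and lift_minus: "lift (a - b) = lift a - lift b"
  using conif_of_surj[of a] conif_of_surj[of b]
  by (auto simp: conif_of_hom[symmetric] conif_of_minus[symmetric] lift_conif_of
      free.eval_add free.eval_mult free.eval_minus)

lemma lift_gens: "lift gX = \<xi>" "lift gY = \<eta>" "lift gZ = \<zeta>" "lift (sc c) = \<iota> c"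
  by (simp_all add: gX_def gY_def gZ_def sc_def lift_conif_of free_gens free_scalar)

lemma lift_one: "lift 1 = 1"
  using lift_gens(4)[of 1] by (simp add: scalar_one)

lemma lift_zero: "lift 0 = 0"
  using lift_add[of 0 0] by simp

end

section \<open>Two-sided ideals and irreducible representations\<close>

definition two_sided :: "'a::ring_1 set \<Rightarrow> bool" where
  "two_sided Q \<longleftrightarrow> 0 \<in> Q \<and> (\<forall>a\<in>Q. \<forall>b\<in>Q. a + b \<in> Q) \<and> (\<forall>a\<in>Q. \<forall>r. r * a \<in> Q \<and> a * r \<in> Q)"

definition two_sided_prime :: "'a::ring_1 set \<Rightarrow> bool" where
  "two_sided_prime Q \<longleftrightarrow> two_sided Q \<and> 1 \<notin> Q \<and>
    (\<forall>a b. (\<forall>r. a * r * b \<in> Q) \<longrightarrow> a \<in> Q \<or> b \<in> Q)"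

locale two_sided_ideal =
  fixes Q :: "'a::ring_1 set"
  assumes two_sided: "two_sided Q"
begin

lemma zero_mem: "0 \<in> Q" and add_mem: "a \<in> Q \<Longrightarrow> b \<in> Q \<Longrightarrow> a + b \<in> Q"
  and left_mem: "a \<in> Q \<Longrightarrow> r * a \<in> Q" and right_mem: "a \<in> Q \<Longrightarrow> a * r \<in> Q"
  using two_sided by (auto simp: two_sided_def)

lemma uminus_mem: "a \<in> Q \<Longrightarrow> - a \<in> Q"
  using left_mem[of a "- 1"] by simp

lemma minus_mem: "a \<in> Q \<Longrightarrow> b \<in> Q \<Longrightarrow> a - b \<in> Q"
  using add_mem[OF _ uminus_mem, of a b] by simp

text \<open>Replaces computing in the quotient ring by chains of congruences in the ring
  itself.\<close>

definition cong :: "'a \<Rightarrow> 'a \<Rightarrow> bool" (infix "\<approx>" 50) where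
  "a \<approx> b \<longleftrightarrow> a - b \<in> Q"

lemma cong_refl [simp]: "a \<approx> a"
  by (simp add: cong_def zero_mem)

lemma cong_sym: "a \<approx> b \<Longrightarrow> b \<approx> a"
  using uminus_mem[of "a - b"] by (simp add: cong_def)

lemma cong_trans [trans]: "a \<approx> b \<Longrightarrow> b \<approx> c \<Longrightarrow> a \<approx> c"
  using add_mem[of "a - b" "b - c"] by (simp add: cong_def)

lemma cong_add: "a \<approx> b \<Longrightarrow> c \<approx> d \<Longrightarrow> a + c \<approx> b + d"
  using add_mem[of "a - b" "c - d"] by (simp add: cong_def algebra_simps)

lemma cong_mult_left: "a \<approx> b \<Longrightarrow> c * a \<approx> c * b"
  using left_mem[of "a - b" c] by (simp add: cong_def algebra_simps)

lemma cong_mult_right: "a \<approx> b \<Longrightarrow> a * c \<approx> b * c"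
  using right_mem[of "a - b" c] by (simp add: cong_def algebra_simps)

lemma cong_mult: "a \<approx> b \<Longrightarrow> c \<approx> d \<Longrightarrow> a * c \<approx> b * d"
  using cong_mult_left cong_mult_right cong_trans by blast

lemma cong_mem: "a \<approx> b \<Longrightarrow> a \<in> Q \<longleftrightarrow> b \<in> Q"
  using add_mem[of "a - b" b] minus_mem[of a "a - b"] by (auto simp: cong_def)

lemma cong_zero: "a \<approx> 0 \<longleftrightarrow> a \<in> Q"
  by (simp add: cong_def)

lemma cong_power: "a \<approx> b \<Longrightarrow> a ^ n \<approx> b ^ n"
  by (induction n) (simp_all add: cong_mult)

end

locale conif_ideal = two_sided_ideal Q for Q :: "conif set"
begin

text \<open>The \<open>2 \<times> 2\<close> matrix by which the products of generators act on \<open>t\<close> has rank one, so \<open>X t\<close>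
  and \<open>Y t\<close> are multiples of a common element \<open>W\<close>.\<close>

lemma corner:
  assumes XX: "gX * gX * t \<approx> sc (p' * p) * t" and XY: "gX * gY * t \<approx> sc (p' * q) * t"
    and YX: "gY * gX * t \<approx> sc (q' * p) * t" and YY: "gY * gY * t \<approx> sc (q' * q) * t"
    and out: "\<gamma> * p + \<delta> * q = 1" and into: "\<gamma>' * p' + \<delta>' * q' = 1"
    and W: "W = (sc \<gamma> * gX + sc \<delta> * gY) * t"
  shows "gX * t \<approx> sc p * W" "gY * t \<approx> sc q * W" "(sc \<gamma>' * gX + sc \<delta>' * gY) * W \<approx> t"
proof -
  \<comment> \<open>Evaluating \<open>Y X X t = X X Y t\<close> on both sides compares
    \<open>p Y t\<close> with \<open>q X t\<close>, up to the factor \<open>p'\<close>. The fact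
    \<open>y\<close> does the same with the factor \<open>q'\<close>, and \<open>into\<close>
    combines the two so that these factors disappear in \<open>parallel\<close>.\<close>
  have x: "sc (p' * p) * (gY * t) \<approx> sc (p' * q) * (gX * t)"
  proof -
    have "sc (p' * p) * (gY * t) = gY * (sc (p' * p) * t)" by (simp add: gen_sc)
    also have "\<dots> \<approx> gY * (gX * gX * t)" by (rule cong_mult_left[OF cong_sym[OF XX]])
    also have "\<dots> = gX * (gX * gY * t)" using gen_rels(4) by (metis mult.assoc)
    also have "\<dots> \<approx> gX * (sc (p' * q) * t)" by (rule cong_mult_left[OF XY])
    also have "\<dots> = sc (p' * q) * (gX * t)" by (simp add: gen_sc)
    finally show ?thesis .
  qed
  have y: "sc (q' * p) * (gY * t) \<approx> sc (q' * q) * (gX * t)"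
  proof -
    have "sc (q' * p) * (gY * t) = gY * (sc (q' * p) * t)" by (simp add: gen_sc)
    also have "\<dots> \<approx> gY * (gY * gX * t)" by (rule cong_mult_left[OF cong_sym[OF YX]])
    also have "\<dots> = gX * (gY * gY * t)" using gen_rels(5) by (metis mult.assoc)
    also have "\<dots> \<approx> gX * (sc (q' * q) * t)" by (rule cong_mult_left[OF YY])
    also have "\<dots> = sc (q' * q) * (gX * t)" by (simp add: gen_sc)
    finally show ?thesis .
  qed
  have split: "sc r * a = sc \<gamma>' * (sc (p' * r) * a) + sc \<delta>' * (sc (q' * r) * a)" for r a
  proof -
    have "r = \<gamma>' * (p' * r) + \<delta>' * (q' * r)"
      using into by (metis distrib_right mult.assoc mult_1)
    then show ?thesis by (metis distrib_right sc_add sc_sc)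
  qed
  have parallel: "sc p * (gY * t) \<approx> sc q * (gX * t)"
    unfolding split[of p] split[of q] by (intro cong_add cong_mult_left x y)
  have unit: "a = sc \<gamma> * (sc p * a) + sc \<delta> * (sc q * a)" for a
    using out by (metis distrib_right sc_add sc_sc sc_one mult_1)
  have "gX * t = sc \<gamma> * (sc p * (gX * t)) + sc \<delta> * (sc q * (gX * t))" by (rule unit)
  also have "\<dots> \<approx> sc \<gamma> * (sc p * (gX * t)) + sc \<delta> * (sc p * (gY * t))"
    by (intro cong_add cong_mult_left cong_sym[OF parallel] cong_refl)
  also have "\<dots> = sc p * W"
    by (simp add: W distrib_left distrib_right gen_sc mult.assoc sc_sc mult.commute)
  finally show "gX * t \<approx> sc p * W" .
  have "gY * t = sc \<gamma> * (sc p * (gY * t)) + sc \<delta> * (sc q * (gY * t))" by (rule unit)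
  also have "\<dots> \<approx> sc \<gamma> * (sc q * (gX * t)) + sc \<delta> * (sc q * (gY * t))"
    by (intro cong_add cong_mult_left parallel cong_refl)
  also have "\<dots> = sc q * W"
    by (simp add: W distrib_left distrib_right gen_sc mult.assoc sc_sc mult.commute)
  finally show "gY * t \<approx> sc q * W" .
  have "(sc \<gamma>' * gX + sc \<delta>' * gY) * W =
      sc \<gamma>' * (sc \<gamma> * (gX * gX * t) + sc \<delta> * (gX * gY * t))
      + sc \<delta>' * (sc \<gamma> * (gY * gX * t) + sc \<delta> * (gY * gY * t))"
    by (simp add: W distrib_left distrib_right gen_sc mult.assoc)
  also have "\<dots> \<approx> sc \<gamma>' * (sc \<gamma> * (sc (p' * p) * t) + sc \<delta> * (sc (p' * q) * t))
      + sc \<delta>' * (sc \<gamma> * (sc (q' * p) * t) + sc \<delta> * (sc (q' * q) * t))"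
    by (intro cong_add cong_mult_left XX XY YX YY)
  also have "\<dots> = sc ((\<gamma>' * p' + \<delta>' * q') * (\<gamma> * p + \<delta> * q)) * t"
    by (simp add: sc_sc distrib_left flip: distrib_right sc_add) (simp add: algebra_simps)
  also have "\<dots> = t" by (simp add: out into)
  finally show "(sc \<gamma>' * gX + sc \<delta>' * gY) * W \<approx> t" .
qed

end


section \<open>Eigenspace projections of \<open>Z\<close> and lifted matrix units\<close>

definition idem_pos :: conif where "idem_pos = sc (1/2) * (1 + gZ)"
definition idem_neg :: conif where "idem_neg = sc (1/2) * (1 - gZ)"

lemma half_add_half: "sc (1/2) * (a + a) = a"
  using sc_cancel[of 2 a] by (simp add: sc_two mult_2 inverse_eq_divide)

lemma gZ_idem: "gZ * idem_pos = idem_pos" "idem_pos * gZ = idem_pos"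
  "gZ * idem_neg = - idem_neg" "idem_neg * gZ = - idem_neg"
  by (simp_all add: idem_pos_def idem_neg_def gen_sc mult.assoc distrib_left distrib_right
      left_diff_distrib right_diff_distrib gen_rels(1))

lemma idem_sum: "idem_pos + idem_neg = 1"
  using half_add_half[of 1] by (simp add: idem_pos_def idem_neg_def flip: distrib_left)

lemma idem_diff: "idem_pos - idem_neg = gZ"
  using half_add_half[of gZ] by (simp add: idem_pos_def idem_neg_def flip: right_diff_distrib)

text \<open>On an eigenvector of \<open>Z\<close> each projection is 1 or 0. Hence a product with a
  projection is known as soon as the sign of \<open>gZ\<close> on the relevant side is.\<close>

lemma idem_left:
  "gZ * a = a \<Longrightarrow> idem_pos * a = a" "gZ * a = a \<Longrightarrow> idem_neg * a = 0"
  "gZ * a = - a \<Longrightarrow> idem_pos * a = 0" "gZ * a = - a \<Longrightarrow> idem_neg * a = a"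
  using half_add_half[of a]
  by (simp_all add: idem_pos_def idem_neg_def mult.assoc distrib_right left_diff_distrib)

lemma idem_right:
  "a * gZ = a \<Longrightarrow> a * idem_pos = a" "a * gZ = a \<Longrightarrow> a * idem_neg = 0"
  "a * gZ = - a \<Longrightarrow> a * idem_pos = 0" "a * gZ = - a \<Longrightarrow> a * idem_neg = a"
  using half_add_half[of a]
  by (simp_all add: idem_pos_def idem_neg_def sc_left_commute sc_commute[of a] distrib_left right_diff_distrib)

lemma gZ_odd: "gZ * ((sc c * gX + sc d * gY) * a) = - ((sc c * gX + sc d * gY) * (gZ * a))"
proof -
  have "gZ * (gX * b) = - (gX * (gZ * b))" "gZ * (gY * b) = - (gY * (gZ * b))" for b
    using gen_rels(2,3) by (metis mult.assoc minus_mult_left minus_minus)+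
  then show ?thesis by (simp add: distrib_right mult.assoc gen_sc distrib_left)
qed

text \<open>Simplicity of the matrix ring: matrix units move a nonzero entry to both diagonal
  places. It yields that the kernels below are prime and also that no proper ideal exceeds
  them.\<close>

lemma mat2_simple: "m \<noteq> 0 \<Longrightarrow> \<exists>a b c d. a * m * b + c * m * d = (1::mat2)"
proof (cases m)
  case (Mat2 p q r t)
  assume "m \<noteq> 0"
  then consider "p \<noteq> 0" | "q \<noteq> 0" | "r \<noteq> 0" | "t \<noteq> 0"
    using Mat2 by (auto simp: zero_mat2_def)
  then show ?thesis
  proof cases
    case 1
    then have "Mat2 (1/p) 0 0 0 * m * Mat2 1 0 0 0 + Mat2 0 0 (1/p) 0 * m * Mat2 0 1 0 0 = 1"
      by (simp add: Mat2 one_mat2_def)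
    then show ?thesis by blast
  next
    case 2
    then have "Mat2 (1/q) 0 0 0 * m * Mat2 0 0 1 0 + Mat2 0 0 (1/q) 0 * m * Mat2 0 0 0 1 = 1"
      by (simp add: Mat2 one_mat2_def)
    then show ?thesis by blast
  next
    case 3
    then have "Mat2 0 (1/r) 0 0 * m * Mat2 1 0 0 0 + Mat2 0 0 0 (1/r) * m * Mat2 0 1 0 0 = 1"
      by (simp add: Mat2 one_mat2_def)
    then show ?thesis by blast
  next
    case 4
    then have "Mat2 0 (1/t) 0 0 * m * Mat2 0 0 1 0 + Mat2 0 0 0 (1/t) * m * Mat2 0 0 0 1 = 1"
      by (simp add: Mat2 one_mat2_def)
    then show ?thesis by blast
  qed
qed

lemma mat2_scalar_mult [simp]:
  "mat2_scalar c * Mat2 p q r t = Mat2 (c * p) (c * q) (c * r) (c * t)"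
  by (simp add: mat2_scalar_def)

text \<open>The four extra parameters certify that neither pair of parallel arrows vanishes, which makes
  the representation irreducible.\<close>

locale simple_quiver_rep = quiver_rep +
  fixes \<alpha> \<beta> \<gamma> \<delta> :: complex
  assumes out: "\<alpha> * x\<^sub>1 + \<beta> * y\<^sub>1 = 1" and into: "\<gamma> * x\<^sub>2 + \<delta> * y\<^sub>2 = 1"
begin

text \<open>Preimages of the two off-diagonal matrix units; the certificates scale the entry to 1.
  With the projections they give the linear section \<open>sect\<close> of
  \<open>lift\<close>.\<close>

definition arrow\<^sub>1 :: conif where "arrow\<^sub>1 = (sc \<alpha> * gX + sc \<beta> * gY) * idem_neg"
definition arrow\<^sub>2 :: conif where "arrow\<^sub>2 = (sc \<gamma> * gX + sc \<delta> * gY) * idem_pos"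

fun sect :: "mat2 \<Rightarrow> conif" where
  "sect (Mat2 p q r t) = sc p * idem_pos + sc q * arrow\<^sub>1 + sc r * arrow\<^sub>2 + sc t * idem_neg"

lemma lift_sect: "lift (sect m) = m"
proof (cases m)
  case (Mat2 p q r t)
  have "lift idem_pos = Mat2 1 0 0 0" "lift idem_neg = Mat2 0 0 0 1"
    by (simp_all add: idem_pos_def idem_neg_def lift_mult lift_add lift_minus lift_gens lift_one one_mat2_def)
  then show ?thesis using out into
    by (simp add: Mat2 arrow\<^sub>1_def arrow\<^sub>2_def lift_mult lift_add lift_gens)
qed

text \<open>By \<open>lift_sect\<close> the middle factor runs through all matrices, so simplicity
  of the matrix ring applies.\<close>

lemma kernel_prime: "two_sided_prime {a. lift a = 0}"
proof -
  have "lift a = 0 \<or> lift b = 0" if "\<forall>r. lift (a * r * b) = 0" for a b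
  proof (rule ccontr)
    assume *: "\<not> (lift a = 0 \<or> lift b = 0)"
    have zero: "lift a * m * lift b = 0" for m
      using that lift_sect[of m] by (metis lift_mult)
    obtain m n m' n' where "m * lift a * n + m' * lift a * n' = 1"
      using mat2_simple * by blast
    then have "lift b = (m * lift a * n + m' * lift a * n') * lift b" by simp
    also have "\<dots> = m * (lift a * n * lift b) + m' * (lift a * n' * lift b)"
      by (simp add: distrib_right mult.assoc)
    also have "\<dots> = 0" by (simp add: zero)
    finally show False using * by simp
  qed
  then show ?thesis
    by (auto simp: two_sided_prime_def two_sided_def lift_add lift_mult lift_zero lift_one)
qed

lemma arrow_table:
  "gZ * arrow\<^sub>1 = arrow\<^sub>1" "arrow\<^sub>1 * gZ = - arrow\<^sub>1"
  "gZ * arrow\<^sub>2 = - arrow\<^sub>2" "arrow\<^sub>2 * gZ = arrow\<^sub>2"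
  by (simp_all only: arrow\<^sub>1_def arrow\<^sub>2_def gZ_odd mult.assoc gZ_idem mult_minus_right minus_minus)

lemma arrow_square: "arrow\<^sub>1 * arrow\<^sub>1 = 0" "arrow\<^sub>2 * arrow\<^sub>2 = 0"
  using idem_right(4)[OF arrow_table(2)] idem_left(2)[OF arrow_table(1)]
    idem_right(1)[OF arrow_table(4)] idem_left(3)[OF arrow_table(3)]
  by (metis mult.assoc mult_zero_right)+

text \<open>All products of the lifted matrix units that hold exactly. Missing are
  \<open>arrow\<^sub>1 * arrow\<^sub>2\<close> and \<open>arrow\<^sub>2 * arrow\<^sub>1\<close>,
  which will be projections only modulo an ideal.\<close>

lemmas unit_table =
  idem_left(1,2)[OF gZ_idem(1)] idem_left(3,4)[OF gZ_idem(3)]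
  idem_left(1,2)[OF arrow_table(1)] idem_left(3,4)[OF arrow_table(3)]
  idem_right(3,4)[OF arrow_table(2)] idem_right(1,2)[OF arrow_table(4)] arrow_square

lemma sect_add: "sect (m + n) = sect m + sect n"
  by (cases m; cases n) (simp add: sc_add distrib_right algebra_simps)

lemma sect_scalar: "sect (mat2_scalar c) = sc c"
  by (simp add: mat2_scalar_def idem_sum flip: distrib_left)

text \<open>The hypotheses make \<open>sect\<close> multiplicative modulo \<open>Q\<close> and
  correct on the generators, so \<open>sect (lift a)\<close> is congruent to \<open>a\<close> and
  the kernel lies in \<open>Q\<close>. Conversely, an element of \<open>Q\<close> with nonzero image
  would, by \<open>mat2_simple\<close>, put 1 into \<open>Q\<close>.\<close>

lemma kernel_unique:
  assumes Q: "two_sided Q" and proper: "1 \<notin> Q"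
    and XX: "gX * gX - sc (x\<^sub>1 * x\<^sub>2) \<in> Q" and YY: "gY * gY - sc (y\<^sub>1 * y\<^sub>2) \<in> Q"
    and XY: "gX * gY - (sc (x\<^sub>1 * y\<^sub>2) * idem_pos + sc (x\<^sub>2 * y\<^sub>1) * idem_neg) \<in> Q"
    and YX: "gY * gX - (sc (y\<^sub>1 * x\<^sub>2) * idem_pos + sc (y\<^sub>2 * x\<^sub>1) * idem_neg) \<in> Q"
  shows "Q = {a. lift a = 0}"
proof -
  interpret conif_ideal Q by unfold_locales (rule Q)
  note rel = XX[folded cong_def] XY[folded cong_def] YX[folded cong_def] YY[folded cong_def]
  note on = rel[THEN cong_mult_right]
  have on_pos: "gX * gX * idem_pos \<approx> sc (x\<^sub>1 * x\<^sub>2) * idem_pos"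
      "gX * gY * idem_pos \<approx> sc (x\<^sub>1 * y\<^sub>2) * idem_pos"
      "gY * gX * idem_pos \<approx> sc (y\<^sub>1 * x\<^sub>2) * idem_pos"
      "gY * gY * idem_pos \<approx> sc (y\<^sub>1 * y\<^sub>2) * idem_pos"
    using on[of idem_pos] by (simp_all add: distrib_right mult.assoc unit_table)
  \<comment> \<open>On the positive eigenspace \<open>X\<close> and \<open>Y\<close> first act by
    \<open>x\<^sub>2\<close>, \<open>y\<^sub>2\<close> and then return by \<open>x\<^sub>1\<close>,
    \<open>y\<^sub>1\<close>. The two certificates therefore enter \<open>corner\<close> in
    exchanged roles.\<close>
  note pos = corner[OF on_pos into out arrow\<^sub>2_def]
  have on_neg: "gX * gX * idem_neg \<approx> sc (x\<^sub>2 * x\<^sub>1) * idem_neg"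
      "gX * gY * idem_neg \<approx> sc (x\<^sub>2 * y\<^sub>1) * idem_neg"
      "gY * gX * idem_neg \<approx> sc (y\<^sub>2 * x\<^sub>1) * idem_neg"
      "gY * gY * idem_neg \<approx> sc (y\<^sub>2 * y\<^sub>1) * idem_neg"
    using on[of idem_neg] by (simp_all add: distrib_right mult.assoc unit_table mult.commute)
  note neg = corner[OF on_neg out into arrow\<^sub>1_def]
  have "arrow\<^sub>1 * arrow\<^sub>2 = (sc \<alpha> * gX + sc \<beta> * gY) * arrow\<^sub>2"
    "arrow\<^sub>2 * arrow\<^sub>1 = (sc \<gamma> * gX + sc \<delta> * gY) * arrow\<^sub>1"
    using unit_table by (metis arrow\<^sub>1_def arrow\<^sub>2_def mult.assoc)+
  then have loops: "arrow\<^sub>1 * arrow\<^sub>2 \<approx> idem_pos" "arrow\<^sub>2 * arrow\<^sub>1 \<approx> idem_neg"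
    using pos(3) neg(3) by simp_all
  have sc_mult_sc: "(sc p * u) * (sc q * v) = sc (p * q) * (u * v)" for p q u v
    by (metis mult.assoc sc_left_commute sc_mult)
  have mult: "sect m * sect n \<approx> sect (m * n)" for m n
  proof (cases m; cases n)
    fix p q r t p' q' r' t'
    assume m: "m = Mat2 p q r t" and n: "n = Mat2 p' q' r' t'"
    have "sect m * sect n = (sc (p * p') * idem_pos + sc (q * r') * (arrow\<^sub>1 * arrow\<^sub>2))
      + (sc (p * q') * arrow\<^sub>1 + sc (q * t') * arrow\<^sub>1) + (sc (r * p') * arrow\<^sub>2 + sc (t * r') * arrow\<^sub>2)
      + (sc (r * q') * (arrow\<^sub>2 * arrow\<^sub>1) + sc (t * t') * idem_neg)"
      by (simp add: m n distrib_left distrib_right sc_mult_sc unit_table)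
    also have "\<dots> \<approx> (sc (p * p') * idem_pos + sc (q * r') * idem_pos)
      + (sc (p * q') * arrow\<^sub>1 + sc (q * t') * arrow\<^sub>1) + (sc (r * p') * arrow\<^sub>2 + sc (t * r') * arrow\<^sub>2)
      + (sc (r * q') * idem_neg + sc (t * t') * idem_neg)"
      by (intro cong_add cong_mult_left loops cong_refl)
    also have "\<dots> = sect (m * n)"
      by (simp add: m n sc_add distrib_right)
    finally show ?thesis .
  qed
  have X: "sect (Mat2 0 x\<^sub>1 x\<^sub>2 0) \<approx> gX"
  proof -
    have "gX = gX * idem_neg + gX * idem_pos"
      by (metis add.commute distrib_left idem_sum mult.right_neutral)
    also have "\<dots> \<approx> sc x\<^sub>1 * arrow\<^sub>1 + sc x\<^sub>2 * arrow\<^sub>2" by (intro cong_add pos neg)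
    finally show ?thesis by (simp add: cong_sym)
  qed
  have Y: "sect (Mat2 0 y\<^sub>1 y\<^sub>2 0) \<approx> gY"
  proof -
    have "gY = gY * idem_neg + gY * idem_pos"
      by (metis add.commute distrib_left idem_sum mult.right_neutral)
    also have "\<dots> \<approx> sc y\<^sub>1 * arrow\<^sub>1 + sc y\<^sub>2 * arrow\<^sub>2" by (intro cong_add pos neg)
    finally show ?thesis by (simp add: cong_sym)
  qed
  have Z: "sect (Mat2 1 0 0 (- 1)) \<approx> gZ"
    using idem_diff by (simp add: sc_minus)
  have retract: "sect (lift a) \<approx> a" for a
  proof (induction a rule: conif_induct)
    case (sc c)
    show ?case by (simp add: lift_gens sect_scalar)
  next
    case (add a b)
    then show ?case by (simp add: lift_add sect_add cong_add)
  next
    case (X a)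
    show ?case unfolding lift_mult lift_gens
      by (rule cong_trans[OF cong_sym[OF mult] cong_mult[OF X \<open>sect (Mat2 0 x\<^sub>1 x\<^sub>2 0) \<approx> gX\<close>]])
  next
    case (Y a)
    show ?case unfolding lift_mult lift_gens
      by (rule cong_trans[OF cong_sym[OF mult] cong_mult[OF Y \<open>sect (Mat2 0 y\<^sub>1 y\<^sub>2 0) \<approx> gY\<close>]])
  next
    case (Z a)
    show ?case unfolding lift_mult lift_gens
      by (rule cong_trans[OF cong_sym[OF mult] cong_mult[OF Z \<open>sect (Mat2 1 0 0 (- 1)) \<approx> gZ\<close>]])
  qed
  have "a \<in> Q" if "lift a = 0" for a
  proof -
    have "sect 0 = 0" by (simp add: zero_mat2_def)
    then show ?thesis using retract[of a] zero_mem cong_mem that by metis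
  qed
  moreover have "lift a = 0" if "a \<in> Q" for a
  proof (rule ccontr)
    assume "lift a \<noteq> 0"
    then obtain m n m' n' where unit: "m * lift a * n + m' * lift a * n' = 1"
      using mat2_simple by blast
    have sandwich: "sect (m * lift a * n) \<in> Q" for m n
    proof -
      have "sect m * sect (lift a) * sect n \<approx> sect (m * lift a * n)"
        by (rule cong_trans[OF cong_mult_right[OF mult] mult])
      moreover have "sect m * sect (lift a) * sect n \<in> Q"
        using that cong_mem[OF retract] left_mem right_mem by blast
      ultimately show ?thesis using cong_mem by blast
    qed
    have "sect 1 \<in> Q"
      using add_mem[OF sandwich sandwich] by (metis sect_add unit)
    moreover have "sect 1 = 1"
      using sect_scalar[of 1] by (simp add: mat2_scalar_def one_mat2_def)
    ultimately show False using proper by simp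
  qed
  ultimately show ?thesis by blast
qed

end

section \<open>Prime ideals above a point\<close>

definition px :: conif where "px = gX * gX"
definition py :: conif where "py = gY * gY"
definition pz :: conif where "pz = sc (1/2) * (gX * gY + gY * gX)"

lemma gZ_gX: "gZ * gX = - (gX * gZ)" and gZ_gY: "gZ * gY = - (gY * gZ)"
  using gen_rels(2,3) by simp_all

lemma odd_odd_commute:
  assumes "u * gZ = - (gZ * u)" "v * gZ = - (gZ * v)"
  shows "u * v * gZ = gZ * (u * v)"
proof -
  have "u * v * gZ = - (u * gZ * v)" by (simp add: mult.assoc assms(2))
  also have "\<dots> = gZ * (u * v)" by (subst assms(1)) (simp add: mult.assoc)
  finally show ?thesis .
qed

lemmas even_commutes_gZ =
  odd_odd_commute[OF gen_rels(2) gen_rels(2)] odd_odd_commute[OF gen_rels(3) gen_rels(3)]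
  odd_odd_commute[OF gen_rels(2) gen_rels(3)] odd_odd_commute[OF gen_rels(3) gen_rels(2)]

lemma px_central: "px * a = a * px"
  unfolding px_def
  by (rule central_if_commutes_gens[OF mult.assoc gen_rels(4) even_commutes_gZ(1)])

lemma py_central: "py * a = a * py"
  unfolding py_def
  by (rule central_if_commutes_gens[OF gen_rels(5) mult.assoc even_commutes_gZ(2)])

lemma anticommutator: "gX * gY + gY * gX = sc 2 * pz"
  by (simp add: pz_def sc_sc)

lemma pz_central: "pz * a = a * pz"
proof -
  have X: "gX * (gX * gY) = gY * gX * gX" and Y: "gY * (gY * gX) = gX * gY * gY"
    using gen_rels(4,5) by (metis mult.assoc)+
  have "(gX * gY + gY * gX) * a = a * (gX * gY + gY * gX)"
    by (rule central_if_commutes_gens)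
      (use X Y even_commutes_gZ in \<open>simp_all add: distrib_left distrib_right mult.assoc\<close>)
  then show ?thesis by (simp add: pz_def sc_left_commute[of a] mult.assoc)
qed

text \<open>The commutator of \<open>X\<close> and \<open>Y\<close> anticommutes with
  \<open>X\<close> and \<open>Y\<close> and commutes with \<open>Z\<close>; the factor
  \<open>Z\<close> corrects the signs.\<close>

definition pw :: conif where "pw = (gX * gY - gY * gX) * gZ"

lemma pw_central: "pw * a = a * pw"
proof (rule central_if_commutes_gens)
  have X: "gX * (gX * (gY * gZ)) = gY * (gX * (gX * gZ))"
    and Y: "gY * (gY * (gX * gZ)) = gX * (gY * (gY * gZ))"
    using gen_rels(4,5) by (metis mult.assoc)+
  have "pw * gX = - ((gX * gY - gY * gX) * gX * gZ)"
    by (simp add: pw_def gZ_gX mult.assoc)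
  also have "\<dots> = gX * pw"
    by (simp add: pw_def X algebra_simps)
  finally show "pw * gX = gX * pw" .
  have "pw * gY = - ((gX * gY - gY * gX) * gY * gZ)"
    by (simp add: pw_def gZ_gY mult.assoc)
  also have "\<dots> = gY * pw"
    by (simp add: pw_def Y algebra_simps)
  finally show "pw * gY = gY * pw" .
  have "(gX * gY - gY * gX) * gZ = gZ * (gX * gY - gY * gX)"
    by (simp add: left_diff_distrib right_diff_distrib even_commutes_gZ)
  then show "pw * gZ = gZ * pw" unfolding pw_def by (metis mult.assoc)
qed

text \<open>Since \<open>gZ * pw\<close> is the commutator, the square of \<open>pw\<close> is that
  of \<open>XY - YX\<close>. It differs from the square of \<open>XY + YX\<close> by four times
  \<open>px * py\<close>, the product of \<open>XY\<close> and \<open>YX\<close> in either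
  order.\<close>

lemma pw_square: "pw * pw = sc 4 * (pz * pz - px * py)"
proof -
  let ?u = "gX * gY" and ?v = "gY * gX"
  have uv: "?u * ?v = px * py" "?v * ?u = px * py"
    unfolding px_def py_def using gen_rels(4,5) by (metis mult.assoc)+
  have "pw * pw = (?u - ?v) * (gZ * pw)" by (simp add: pw_def mult.assoc)
  also have "gZ * pw = pw * gZ" by (rule pw_central[symmetric])
  also have "\<dots> = ?u - ?v" by (simp add: pw_def mult.assoc gen_rels(1))
  finally have "pw * pw = (?u - ?v) * (?u - ?v)" .
  moreover have "sc 4 * (pz * pz) = (?u + ?v) * (?u + ?v)"
    unfolding anticommutator by (simp add: sc_left_commute[of pz] sc_sc mult.assoc)
  moreover have "sc 4 * t = t + t + (t + t)" for t
    using sc_add[of 2 2] by (simp add: sc_two distrib_right flip: mult_2)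
  ultimately show ?thesis
    by (simp only: right_diff_distrib left_diff_distrib distrib_left distrib_right uv) simp
qed

text \<open>The fibre condition in coordinates; \<open>prime_peval_mem\<close> identifies it with
  the contraction being the ideal of the point.\<close>

definition lies_above :: "conif set \<Rightarrow> complex \<Rightarrow> complex \<Rightarrow> complex \<Rightarrow> bool" where
  "lies_above Q a b c \<longleftrightarrow> px - sc a \<in> Q \<and> py - sc b \<in> Q \<and> pz - sc c \<in> Q"

text \<open>As \<open>pw\<close> is central, the two factors around any \<open>r\<close> multiply to
  \<open>r\<close> times \<open>pw * pw - sc (2 * s) * sc (2 * s)\<close>, which lies in
  \<open>Q\<close> by \<open>pw_square\<close>.\<close>

lemma prime_above_root:
  assumes Q: "two_sided_prime Q" and lies_above: "lies_above Q a b c" and s: "s * s = c * c - a * b"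
  shows "pw - sc (2 * s) \<in> Q \<or> pw - sc (2 * - s) \<in> Q"
proof -
  interpret two_sided_ideal Q using Q by unfold_locales (simp add: two_sided_prime_def)
  have p: "px \<approx> sc a" "py \<approx> sc b" "pz \<approx> sc c"
    using lies_above by (simp_all add: lies_above_def cong_def)
  \<comment> \<open>The difference is written as a sum so that congruence of sums and products
    suffices.\<close>
  have "pz * pz + (- 1) * (px * py) \<approx> sc c * sc c + (- 1) * (sc a * sc b)"
    by (intro cong_add cong_mult cong_refl p)
  then have "pz * pz - px * py \<approx> sc (s * s)" by (simp add: s sc_diff sc_mult)
  then have "pw * pw \<approx> sc 4 * sc (s * s)"
    unfolding pw_square by (rule cong_mult_left)
  then have root: "pw * pw - sc (2 * s) * sc (2 * s) \<in> Q"
    by (simp add: cong_def mult.assoc mult.left_commute flip: sc_mult)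
  have "(pw - sc (2 * s)) * r * (pw - sc (2 * - s)) \<in> Q" for r
  proof -
    have "(pw - sc (2 * s)) * r * (pw - sc (2 * - s)) = r * (pw * pw - sc (2 * s) * sc (2 * s))"
      using pw_central[of r] sc_commute[of r "2 * s"] sc_commute[of pw "2 * s"] sc_left_commute[of r "2 * s"]
      by (simp add: sc_minus left_diff_distrib right_diff_distrib distrib_left distrib_right mult.assoc)
    then show ?thesis using left_mem[OF root] by simp
  qed
  then show ?thesis using Q by (auto simp: two_sided_prime_def)
qed

lemma (in simple_quiver_rep) lift_p:
  "lift px = mat2_scalar (x\<^sub>1 * x\<^sub>2)" "lift py = mat2_scalar (y\<^sub>1 * y\<^sub>2)"
  "lift pz = mat2_scalar ((x\<^sub>1 * y\<^sub>2 + x\<^sub>2 * y\<^sub>1) / 2)"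
  "lift pw = mat2_scalar (x\<^sub>1 * y\<^sub>2 - x\<^sub>2 * y\<^sub>1)"
  by (simp_all add: px_def py_def pz_def pw_def lift_mult lift_add lift_minus lift_gens mat2_scalar_def
      field_simps)

text \<open>Modulo \<open>Q\<close> the sum of \<open>XY\<close> and \<open>YX\<close> is
  \<open>2c\<close> and their difference is \<open>2sZ\<close>. So they are \<open>c + sZ\<close>
  and \<open>c - sZ\<close>, and splitting \<open>Z\<close> into its projections gives the
  hypotheses of \<open>kernel_unique\<close>.\<close>

lemma (in simple_quiver_rep) prime_above_unique:
  assumes Q: "two_sided_prime Q" and lies_above: "lies_above Q (x\<^sub>1 * x\<^sub>2) (y\<^sub>1 * y\<^sub>2) c"
    and s: "x\<^sub>1 * y\<^sub>2 = c + s" "x\<^sub>2 * y\<^sub>1 = c - s" and root: "pw - sc (2 * s) \<in> Q"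
  shows "Q = {a. lift a = 0}"
proof (rule kernel_unique)
  show "two_sided Q" "1 \<notin> Q" using Q by (simp_all add: two_sided_prime_def)
  then interpret two_sided_ideal Q by unfold_locales
  show "gX * gX - sc (x\<^sub>1 * x\<^sub>2) \<in> Q" "gY * gY - sc (y\<^sub>1 * y\<^sub>2) \<in> Q"
    using lies_above by (simp_all add: lies_above_def px_def py_def)
  have "pw * gZ \<approx> sc (2 * s) * gZ"
    using root by (intro cong_mult_right) (simp add: cong_def)
  then have minus: "gX * gY - gY * gX \<approx> sc (2 * s) * gZ"
    by (simp add: pw_def mult.assoc gen_rels(1))
  have plus: "gX * gY + gY * gX \<approx> sc 2 * sc c"
    unfolding anticommutator using lies_above by (intro cong_mult_left) (simp add: lies_above_def cong_def)
  have idem: "sc (c + t) * idem_pos + sc (c - t) * idem_neg = sc c + sc t * gZ" for t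
  proof -
    have "sc (c + t) * idem_pos + sc (c - t) * idem_neg
        = sc c * (idem_pos + idem_neg) + sc t * (idem_pos - idem_neg)"
      by (simp add: sc_add sc_diff distrib_left distrib_right left_diff_distrib right_diff_distrib)
    then show ?thesis by (simp add: idem_sum idem_diff)
  qed
  have half: "a = sc (1/2) * ((a + b) + (a - b))" for a b
    using half_add_half[of a] by simp
  have "gX * gY = sc (1/2) * ((gX * gY + gY * gX) + (gX * gY - gY * gX))" by (rule half)
  also have "\<dots> \<approx> sc (1/2) * (sc 2 * sc c + sc (2 * s) * gZ)"
    by (intro cong_mult_left cong_add plus minus)
  also have "\<dots> = sc (x\<^sub>1 * y\<^sub>2) * idem_pos + sc (x\<^sub>2 * y\<^sub>1) * idem_neg"
    unfolding s idem by (simp add: distrib_left sc_sc)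
  finally show "gX * gY - (sc (x\<^sub>1 * y\<^sub>2) * idem_pos + sc (x\<^sub>2 * y\<^sub>1) * idem_neg) \<in> Q"
    by (simp add: cong_def)
  have "gY * gX = sc (1/2) * ((gX * gY + gY * gX) + (- 1) * (gX * gY - gY * gX))"
    using half[of "gY * gX" "gX * gY"] by (simp add: algebra_simps)
  also have "\<dots> \<approx> sc (1/2) * (sc 2 * sc c + (- 1) * (sc (2 * s) * gZ))"
    by (intro cong_mult_left cong_add plus minus)
  also have "\<dots> = sc (c + - s) * idem_pos + sc (c - - s) * idem_neg"
    unfolding idem by (simp add: distrib_left right_diff_distrib sc_sc sc_minus)
  also have "\<dots> = sc (y\<^sub>1 * x\<^sub>2) * idem_pos + sc (y\<^sub>2 * x\<^sub>1) * idem_neg"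
    using s by (simp add: mult.commute)
  finally show "gY * gX - (sc (y\<^sub>1 * x\<^sub>2) * idem_pos + sc (y\<^sub>2 * x\<^sub>1) * idem_neg) \<in> Q"
    by (simp add: cong_def)
qed

text \<open>Rank-one factorisation of the matrix with rows (a, c + s) and (c - s, b). The case split
  searches for a nonzero pivot; if \<open>a\<close> and \<open>b\<close> vanish, one off-diagonal
  entry is \<open>2 * c\<close>.\<close>

lemma exists_arrows:
  fixes a b c s :: complex
  assumes nz: "(a, b, c) \<noteq> (0, 0, 0)" and s: "s * s = c * c - a * b"
  obtains x\<^sub>1 x\<^sub>2 y\<^sub>1 y\<^sub>2 \<alpha> \<beta> \<gamma> \<delta> where "x\<^sub>1 * x\<^sub>2 = a" "y\<^sub>1 * y\<^sub>2 = b"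
    "x\<^sub>1 * y\<^sub>2 = c + s" "x\<^sub>2 * y\<^sub>1 = c - s" "\<alpha> * x\<^sub>1 + \<beta> * y\<^sub>1 = 1" "\<gamma> * x\<^sub>2 + \<delta> * y\<^sub>2 = 1"
proof -
  have ab: "(c + s) * (c - s) = a * b" using s by (simp add: algebra_simps)
  show thesis
  proof (cases "a = 0")
    case False
    show ?thesis
      by (rule that[of 1 a "(c - s) / a" "c + s" 1 0 "1 / a" 0]) (use False ab in \<open>simp_all add: mult.commute\<close>)
  next
    case a: True
    show ?thesis
    proof (cases "b = 0")
      case False
      show ?thesis
        by (rule that[of "(c + s) / b" "c - s" 1 b 0 1 0 "1 / b"]) (use False ab in simp_all)
    next
      case b: True
      have "s = c \<or> s = - c" using ab a b by (auto simp: add_eq_0_iff)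
      then show ?thesis
      proof
        assume "s = c"
        then show ?thesis
          by (intro that[of 1 0 0 "2 * c" 1 0 0 "1 / (2 * c)"]) (use nz a b in simp_all)
      next
        assume "s = - c"
        then show ?thesis
          by (intro that[of 0 "2 * c" 1 0 0 1 "1 / (2 * c)" 0]) (use nz a b in simp_all)
      qed
    qed
  qed
qed

lemma unique_prime_above:
  assumes nz: "(a, b, c) \<noteq> (0, 0, 0)" and s: "s * s = c * c - a * b"
  shows "\<exists>!Q. two_sided_prime Q \<and> lies_above Q a b c \<and> pw - sc (2 * s) \<in> Q"
proof -
  obtain x\<^sub>1 x\<^sub>2 y\<^sub>1 y\<^sub>2 \<alpha> \<beta> \<gamma> \<delta> where *: "x\<^sub>1 * x\<^sub>2 = a" "y\<^sub>1 * y\<^sub>2 = b"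
    "x\<^sub>1 * y\<^sub>2 = c + s" "x\<^sub>2 * y\<^sub>1 = c - s" "\<alpha> * x\<^sub>1 + \<beta> * y\<^sub>1 = 1" "\<gamma> * x\<^sub>2 + \<delta> * y\<^sub>2 = 1"
    using exists_arrows[OF assms] .
  interpret simple_quiver_rep x\<^sub>1 x\<^sub>2 y\<^sub>1 y\<^sub>2 \<alpha> \<beta> \<gamma> \<delta> by unfold_locales (fact *)+
  have "lies_above {a. lift a = 0} a b c" "lift (pw - sc (2 * s)) = 0"
    by (simp_all add: lies_above_def lift_minus lift_p lift_gens *)
  moreover have "Q = {a. lift a = 0}"
    if "two_sided_prime Q" "lies_above Q a b c" "pw - sc (2 * s) \<in> Q" for Q
    by (rule prime_above_unique[of Q c s]) (use that * in simp_all)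
  ultimately show ?thesis
    by (intro ex1I[of _ "{a. lift a = 0}"] conjI kernel_prime) blast+
qed

text \<open>Each root has its own prime. A prime containing both \<open>pw - sc (2 * s)\<close> and
  \<open>pw + sc (2 * s)\<close> contains \<open>sc (4 * s)\<close>, a unit unless
  \<open>s = 0\<close>.\<close>

lemma primes_above_nonzero_card:
  assumes nz: "(a, b, c) \<noteq> (0, 0, 0)"
  shows "card {Q. two_sided_prime Q \<and> lies_above Q a b c} = (if a * b = c * c then 1 else 2)"
proof -
  define s where "s = csqrt (c * c - a * b)"
  have s: "s * s = c * c - a * b" "- s * - s = c * c - a * b"
    using power2_csqrt[of "c * c - a * b"] by (simp_all add: s_def power2_eq_square)
  obtain K where K: "two_sided_prime K" "lies_above K a b c" "pw - sc (2 * s) \<in> K"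
      "\<And>Q. two_sided_prime Q \<Longrightarrow> lies_above Q a b c \<Longrightarrow> pw - sc (2 * s) \<in> Q \<Longrightarrow> Q = K"
    using unique_prime_above[OF nz s(1)] by blast
  obtain L where L: "two_sided_prime L" "lies_above L a b c" "pw - sc (2 * - s) \<in> L"
      "\<And>Q. two_sided_prime Q \<Longrightarrow> lies_above Q a b c \<Longrightarrow> pw - sc (2 * - s) \<in> Q \<Longrightarrow> Q = L"
    using unique_prime_above[OF nz s(2)] by blast
  have set: "{Q. two_sided_prime Q \<and> lies_above Q a b c} = {K, L}"
    using K L prime_above_root[OF _ _ s(1)] by blast
  show ?thesis
  proof (cases "a * b = c * c")
    case True
    then have "s = 0" by (simp add: s_def)
    then have "K = L" using K(4)[OF L(1,2)] L(3) by simp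
    then show ?thesis using set True by simp
  next
    case False
    then have "s \<noteq> 0" using s by auto
    interpret two_sided_ideal K using K(1) by unfold_locales (simp add: two_sided_prime_def)
    have "K \<noteq> L"
    proof
      assume "K = L"
      then have "(pw - sc (2 * - s)) - (pw - sc (2 * s)) \<in> K" using K(3) L(3) minus_mem by blast
      then have "sc (4 * s) \<in> K" by (simp add: sc_minus flip: sc_add)
      then have "sc (inverse (4 * s)) * sc (4 * s) \<in> K" by (rule left_mem)
      then have "1 \<in> K" using \<open>s \<noteq> 0\<close> by (simp flip: sc_mult)
      then show False using K(1) by (simp add: two_sided_prime_def)
    qed
    then show ?thesis using set False by simp
  qed
qed

section \<open>Primes above the origin\<close>

context sign_rep
begin

lemma kernel_prime: "two_sided_prime {a. lift a = 0}"
proof -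
  have "lift a = 0 \<or> lift b = 0" if "\<forall>r. lift (a * r * b) = 0" for a b
    using that[rule_format, of 1] by (simp add: lift_mult)
  then show ?thesis
    by (auto simp: two_sided_prime_def two_sided_def lift_add lift_mult lift_zero lift_one)
qed

lemma kernel_over: "lies_above {a. lift a = 0} 0 0 0" "lift (gZ - sc \<epsilon>) = 0"
  by (simp_all add: lies_above_def px_def py_def pz_def lift_mult lift_add lift_minus lift_gens)

lemma kernel_unique:
  assumes Q: "two_sided Q" and proper: "1 \<notin> Q" and X: "gX \<in> Q" and Y: "gY \<in> Q" and Z: "gZ - sc \<epsilon> \<in> Q"
  shows "Q = {a. lift a = 0}"
proof -
  interpret two_sided_ideal Q by unfold_locales (rule Q)
  have retract: "a \<approx> sc (lift a)" for a
  proof (induction a rule: conif_induct)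
    case (add a b)
    then show ?case by (simp add: lift_add sc_add cong_add)
  next
    case (Z a)
    then have "a * gZ \<approx> sc (lift a) * sc \<epsilon>"
      by (intro cong_mult) (simp_all add: cong_def \<open>gZ - sc \<epsilon> \<in> Q\<close>)
    then show ?case by (simp add: lift_mult lift_gens sc_mult)
  qed (simp_all add: lift_mult lift_gens cong_zero left_mem \<open>gX \<in> Q\<close> \<open>gY \<in> Q\<close>)
  have "a \<in> Q \<longleftrightarrow> lift a = 0" for a
  proof
    assume "a \<in> Q"
    then have "sc (lift a) \<in> Q" using cong_mem[OF retract] by blast
    then have "sc (inverse (lift a)) * sc (lift a) \<in> Q" by (rule left_mem)
    then show "lift a = 0" using proper by (cases "lift a = 0") (simp_all flip: sc_mult)
  next
    assume "lift a = 0"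
    then show "a \<in> Q" using retract[of a] by (simp add: cong_zero)
  qed
  then show ?thesis by blast
qed

end

text \<open>Modulo \<open>Q\<close> the elements \<open>X\<close> and \<open>Y\<close> square to
  zero and anticommute. In \<open>gX * r * gX\<close> the right factor can thus be moved leftwards
  past each letter of \<open>r\<close> up to sign, until it meets the left one; likewise for
  \<open>gY\<close>. Once both lie in \<open>Q\<close>, \<open>Z\<close> is central modulo
  \<open>Q\<close>.\<close>

lemma prime_above_zero:
  assumes Q: "two_sided_prime Q" and lies_above: "lies_above Q 0 0 0"
  shows "gX \<in> Q" "gY \<in> Q" "gZ - sc 1 \<in> Q \<or> gZ - sc (- 1) \<in> Q"
proof -
  interpret two_sided_ideal Q using Q by unfold_locales (simp add: two_sided_prime_def)
  have prime: "(\<And>r. a * r * b \<in> Q) \<Longrightarrow> a \<in> Q \<or> b \<in> Q" for a b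
    using Q by (auto simp: two_sided_prime_def)
  have p: "gX * gX \<in> Q" "gY * gY \<in> Q" "gX * gY + gY * gX \<in> Q"
    using lies_above left_mem by (simp_all add: lies_above_def px_def py_def anticommutator)
  have "gX * r * gX \<in> Q" for r
  proof (induction r rule: conif_induct)
    case (sc c)
    show ?case using left_mem[OF p(1)] by (simp add: gen_sc mult.assoc)
  next
    case (add a b)
    then show ?case using add_mem by (simp add: distrib_left distrib_right)
  next
    case (X a)
    show ?case using right_mem[OF X, of gX] by (simp add: mult.assoc)
  next
    case (Y a)
    have "gX * a * (gX * gY + gY * gX) - gX * a * gX * gY \<in> Q"
      using minus_mem left_mem[OF p(3)] right_mem[OF Y] by blast
    then show ?case by (simp add: distrib_left mult.assoc)
  next
    case (Z a)
    show ?case using uminus_mem[OF right_mem[OF Z, of gZ]] by (simp add: gZ_gX mult.assoc)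
  qed
  then show X: "gX \<in> Q" using prime by blast
  have "gY * r * gY \<in> Q" for r
  proof (induction r rule: conif_induct)
    case (sc c)
    show ?case using left_mem[OF p(2)] by (simp add: gen_sc mult.assoc)
  next
    case (add a b)
    then show ?case using add_mem by (simp add: distrib_left distrib_right)
  next
    case (X a)
    have "gY * a * (gX * gY + gY * gX) - gY * a * gY * gX \<in> Q"
      using minus_mem left_mem[OF p(3)] right_mem[OF X] by blast
    then show ?case by (simp add: distrib_left mult.assoc)
  next
    case (Y a)
    show ?case using right_mem[OF Y, of gY] by (simp add: mult.assoc)
  next
    case (Z a)
    show ?case using uminus_mem[OF right_mem[OF Z, of gZ]] by (simp add: gZ_gY mult.assoc)
  qed
  then show Y: "gY \<in> Q" using prime by blast
  have commute: "gZ * r \<approx> r * gZ" for r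
  proof (induction r rule: conif_induct)
    case (add a b)
    then show ?case by (simp add: distrib_left distrib_right cong_add)
  next
    case (Z a)
    show ?case using cong_mult_right[OF Z, of gZ] by (simp add: mult.assoc)
  qed (simp_all add: gen_sc cong_def minus_mem left_mem right_mem \<open>gX \<in> Q\<close> \<open>gY \<in> Q\<close>)
  have "(gZ - sc 1) * r * (gZ - sc (- 1)) \<in> Q" for r
  proof -
    \<comment> \<open>Because \<open>gZ * gZ = 1\<close>, the product for the two candidate signs
      contains a commutator with \<open>gZ\<close> as a factor.\<close>
    have "(gZ - sc 1) * r * (gZ - sc (- 1)) = (gZ * r - r * gZ) * (gZ + 1)"
      by (simp add: sc_minus algebra_simps gen_rels(1))
    then show ?thesis using right_mem commute by (simp add: cong_def)
  qed
  then show "gZ - sc 1 \<in> Q \<or> gZ - sc (- 1) \<in> Q" by (rule prime)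
qed

lemma primes_above_zero_card: "card {Q. two_sided_prime Q \<and> lies_above Q 0 0 0} = 2"
proof -
  interpret plus: sign_rep 1 by unfold_locales simp
  interpret minus: sign_rep "- 1" by unfold_locales simp
  let ?K = "{a. plus.lift a = 0}" and ?L = "{a. minus.lift a = 0}"
  have "Q = ?K \<or> Q = ?L" if Q: "two_sided_prime Q" and above: "lies_above Q 0 0 0" for Q
  proof -
    note mem = prime_above_zero[OF Q above]
    have "two_sided Q" "1 \<notin> Q" using Q by (simp_all add: two_sided_prime_def)
    with mem show ?thesis using plus.kernel_unique[of Q] minus.kernel_unique[of Q] by blast
  qed
  then have "{Q. two_sided_prime Q \<and> lies_above Q 0 0 0} = {?K, ?L}"
    using plus.kernel_prime minus.kernel_prime plus.kernel_over(1) minus.kernel_over(1) by blast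
  moreover have "gZ - sc 1 \<in> ?K" "gZ - sc 1 \<notin> ?L"
    using plus.kernel_over by (simp_all add: minus.lift_minus minus.lift_gens minus.lift_one)
  then have "?K \<noteq> ?L" by blast
  ultimately show ?thesis by simp
qed

section \<open>The Nullstellensatz\<close>

abbreviation mon_const :: "complex \<Rightarrow> 'm::monoid_add \<Rightarrow>\<^sub>0 complex" where
  "mon_const \<equiv> Poly_Mapping.single 0"

lemma poly_mapping_sum_single:
  fixes p :: "'m \<Rightarrow>\<^sub>0 'k::comm_monoid_add"
  shows "p = (\<Sum>m\<in>Poly_Mapping.keys p. Poly_Mapping.single m (Poly_Mapping.lookup p m))"
proof (rule poly_mapping_eqI)
  fix n
  have "Poly_Mapping.lookup (\<Sum>m\<in>Poly_Mapping.keys p. Poly_Mapping.single m (Poly_Mapping.lookup p m)) n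
      = (\<Sum>m\<in>Poly_Mapping.keys p. if m = n then Poly_Mapping.lookup p m else 0)"
    by (simp add: lookup_sum lookup_single when_def)
  then show "Poly_Mapping.lookup p n =
      Poly_Mapping.lookup (\<Sum>m\<in>Poly_Mapping.keys p. Poly_Mapping.single m (Poly_Mapping.lookup p m)) n"
    by (simp add: sum.delta in_keys_iff)
qed

lemma uncountable_UNIV_complex: "uncountable (UNIV :: complex set)"
proof
  assume "countable (UNIV :: complex set)"
  then have "countable (range complex_of_real)" by (rule countable_subset[rotated]) simp
  then have "countable (UNIV :: real set)"
    using countable_image_inj_on[of complex_of_real UNIV] by (simp add: inj_on_def)
  then show False using uncountable_UNIV_real by simp
qed

lemma vector_space_poly_mapping:
  "vector_space (\<lambda>c (p :: 'm::comm_monoid_add \<Rightarrow>\<^sub>0 complex). mon_const c * p)"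
  by unfold_locales (simp_all add: distrib_left distrib_right single_add mult_single flip: mult.assoc)

text \<open>All members of \<open>S\<close> lie in the span of the finitely many monomials with
  exponents in \<open>B\<close>.\<close>

lemma infinite_bounded_dependent:
  fixes S :: "('m::comm_monoid_add \<Rightarrow>\<^sub>0 complex) set"
  assumes "infinite S" and B: "finite B" and keys: "\<And>p. p \<in> S \<Longrightarrow> Poly_Mapping.keys p \<subseteq> B"
  obtains T u where "finite T" "T \<subseteq> S" "(\<Sum>p\<in>T. mon_const (u p) * p) = 0" "\<exists>p\<in>T. u p \<noteq> 0"
proof -
  interpret vector_space "\<lambda>c (p :: 'm \<Rightarrow>\<^sub>0 complex). mon_const c * p" by (rule vector_space_poly_mapping)
  let ?M = "(\<lambda>m. Poly_Mapping.single m 1) ` B :: ('m \<Rightarrow>\<^sub>0 complex) set"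
  have "p \<in> span ?M" if "p \<in> S" for p
  proof -
    have "(\<Sum>m\<in>Poly_Mapping.keys p. mon_const (Poly_Mapping.lookup p m) * Poly_Mapping.single m 1) \<in> span ?M"
      using keys[OF that] by (intro span_sum span_scale span_base) auto
    then show ?thesis by (subst poly_mapping_sum_single[of p]) (simp add: mult_single)
  qed
  then have "dependent S"
    using independent_span_bound[of ?M S] \<open>infinite S\<close> B by blast
  then show ?thesis unfolding dependent_explicit using that by blast
qed

text \<open>Here \<open>poly (map_poly mon_const f) g\<close> is f(g), a univariate complex
  polynomial evaluated at an element of the monoid algebra. Compatibility with linear factors is all
  the multiplicativity required.\<close>

lemma map_poly_mon_const:
  fixes f h :: "complex poly" and g :: "'m::comm_monoid_add \<Rightarrow>\<^sub>0 complex"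
  shows "poly (map_poly mon_const (f + h)) g = poly (map_poly mon_const f) g + poly (map_poly mon_const h) g"
    and "poly (map_poly mon_const (smult c f)) g = mon_const c * poly (map_poly mon_const f) g"
    and "poly (map_poly mon_const ([:- c, 1:] * f)) g = (g - mon_const c) * poly (map_poly mon_const f) g"
proof -
  show "poly (map_poly mon_const (f + h)) g = poly (map_poly mon_const f) g + poly (map_poly mon_const h) g"
    for f h :: "complex poly"
  proof -
    have "map_poly mon_const (f + h) = (map_poly mon_const f + map_poly mon_const h :: ('m \<Rightarrow>\<^sub>0 complex) poly)"
      by (rule poly_eqI) (simp add: coeff_map_poly single_add)
    then show ?thesis by simp
  qed
  note add = this
  show "poly (map_poly mon_const (smult c f)) g = mon_const c * poly (map_poly mon_const f) g"
    for c and f :: "complex poly"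
  proof -
    have "map_poly mon_const (smult c f) = smult (mon_const c :: 'm \<Rightarrow>\<^sub>0 complex) (map_poly mon_const f)"
      by (rule poly_eqI) (simp add: coeff_map_poly mult_single)
    then show ?thesis by simp
  qed
  note smult = this
  have "[:- c, 1:] * f = smult (- c) f + pCons 0 f" by simp
  then show "poly (map_poly mon_const ([:- c, 1:] * f)) g = (g - mon_const c) * poly (map_poly mon_const f) g"
    by (simp only: add smult) (simp add: map_poly_pCons single_uminus algebra_simps)
qed

text \<open>Maximality in the form that the quotient is a field.\<close>

locale maximal_poly_ideal = two_sided_ideal M
  for M :: "('m::comm_monoid_add \<Rightarrow>\<^sub>0 complex) set" +
  assumes proper: "1 \<notin> M"
    and inverse: "\<And>p. p \<notin> M \<Longrightarrow> \<exists>q. q * p - 1 \<in> M"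
begin

lemma sum_mem: "(\<And>i. i \<in> I \<Longrightarrow> f i \<in> M) \<Longrightarrow> sum f I \<in> M"
  by (induction I rule: infinite_finite_induct) (auto intro: add_mem zero_mem)

lemma const_mem: "mon_const c \<in> M \<Longrightarrow> c = 0"
  using left_mem[of "mon_const c" "mon_const (inverse c)"] proper
  by (cases "c = 0") (simp_all add: mult_single)

lemma prime: "p * q \<in> M \<Longrightarrow> p \<in> M \<or> q \<in> M"
proof (rule disjCI)
  assume pq: "p * q \<in> M" and "q \<notin> M"
  then obtain r where r: "r * q - 1 \<in> M" using inverse by blast
  have "r * (p * q) - p * (r * q - 1) \<in> M"
    by (rule minus_mem[OF left_mem[OF pq] left_mem[OF r]])
  then show "p \<in> M" by (simp add: algebra_simps)
qed

text \<open>Over the complex numbers \<open>f\<close> splits into linear factors, and the prime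
  ideal \<open>M\<close> must contain one of them evaluated at \<open>g\<close>, since it contains
  no nonzero constant.\<close>

lemma root_mem:
  fixes f :: "complex poly"
  assumes "f \<noteq> 0" "poly (map_poly mon_const f) g \<in> M"
  shows "\<exists>a. g - mon_const a \<in> M"
  using assms
proof (induction "degree f" arbitrary: f)
  case 0
  obtain c where c: "f = [:c:]" by (rule degree_eq_zeroE[OF 0(1)[symmetric]])
  then have "mon_const c \<in> M" using 0(3) by (simp add: map_poly_pCons)
  then show ?case using const_mem c 0(2) by auto
next
  case (Suc n)
  have "\<not> constant (poly f)" using Suc(2) by (simp add: constant_degree)
  then obtain z where "poly f z = 0" using fundamental_theorem_of_algebra by blast
  then obtain r where r: "f = [:- z, 1:] * r" by (metis poly_eq_0_iff_dvd dvdE)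
  then have "(g - mon_const z) * poly (map_poly mon_const r) g \<in> M"
    using Suc(4) unfolding r map_poly_mon_const(3) by blast
  then have "g - mon_const z \<in> M \<or> poly (map_poly mon_const r) g \<in> M" by (rule prime)
  moreover have "r \<noteq> 0" using Suc(3) r by auto
  moreover have "degree f = Suc (degree r)"
    unfolding r using degree_mult_eq[of "[:- z, 1:]" r] \<open>r \<noteq> 0\<close> by simp
  then have "n = degree r" using Suc(2) by simp
  ultimately show ?case using Suc(1)[of r] by blast
qed

text \<open>Cardinality argument: if no \<open>g - a\<close> lies in \<open>M\<close>, then the inverses of the \<open>g - a\<close> modulo \<open>M\<close>
  are linearly independent; but there are uncountably many of them, so infinitely many lie in a
  common finite-dimensional space.\<close>

lemma nullstellensatz:
  assumes B: "\<And>d. finite (B d)" and cover: "\<And>p :: 'm \<Rightarrow>\<^sub>0 complex. \<exists>d::nat. Poly_Mapping.keys p \<subseteq> B d"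
  shows "\<exists>a. g - mon_const a \<in> M"
proof (rule ccontr)
  assume none: "\<not> (\<exists>a. g - mon_const a \<in> M)"
  then have "\<forall>a. \<exists>h. h * (g - mon_const a) - 1 \<in> M" using inverse by blast
  then obtain h where h: "\<And>a. h a * (g - mon_const a) - 1 \<in> M" by metis
  have "inj h"
  proof (rule injI)
    fix a b assume "h a = h b"
    moreover have "(h a * (g - mon_const a) - 1) - (h b * (g - mon_const b) - 1) \<in> M"
      by (rule minus_mem[OF h h])
    ultimately have "h a * mon_const (b - a) \<in> M" by (simp add: algebra_simps single_diff)
    moreover have "h a \<notin> M"
    proof
      assume "h a \<in> M"
      then have "h a * (g - mon_const a) - (h a * (g - mon_const a) - 1) \<in> M"
        using h left_mem right_mem minus_mem by blast
      then show False using proper by simp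
    qed
    ultimately have "mon_const (b - a) \<in> M" using prime by blast
    then show "a = b" using const_mem by fastforce
  qed
  have "UNIV = (\<Union>d. {a. Poly_Mapping.keys (h a) \<subseteq> B d})" using cover by blast
  then have "\<exists>d. uncountable {a. Poly_Mapping.keys (h a) \<subseteq> B d}"
    using uncountable_UNIV_complex countable_UN[of "UNIV :: nat set" "\<lambda>d. {a. Poly_Mapping.keys (h a) \<subseteq> B d}"]
    by auto
  then obtain d where d: "uncountable {a. Poly_Mapping.keys (h a) \<subseteq> B d}" ..
  let ?S = "h ` {a. Poly_Mapping.keys (h a) \<subseteq> B d}"
  have S: "infinite ?S"
  proof
    assume "finite ?S"
    then have "finite {a. Poly_Mapping.keys (h a) \<subseteq> B d}"
      by (rule finite_imageD) (rule inj_on_subset[OF \<open>inj h\<close> subset_UNIV])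
    then show False using d countable_finite by blast
  qed
  obtain T u where T: "finite T" "T \<subseteq> ?S"
      "(\<Sum>p\<in>T. mon_const (u p) * p) = 0" "\<exists>p\<in>T. u p \<noteq> 0"
    by (rule infinite_bounded_dependent[OF S B[of d]]) auto
  define A where "A = h -` T"
  have A: "finite A" "T = h ` A" "inj_on h A"
    using T(2) finite_vimageI[OF T(1) \<open>inj h\<close>] inj_on_subset[OF \<open>inj h\<close> subset_UNIV]
    by (auto simp: A_def)
  define v where "v a = u (h a)" for a
  have dep: "(\<Sum>a\<in>A. mon_const (v a) * h a) = 0"
    using T(3) A by (simp add: sum.reindex v_def)
  obtain a\<^sub>0 where a\<^sub>0: "a\<^sub>0 \<in> A" "v a\<^sub>0 \<noteq> 0" using T(4) A by (auto simp: v_def)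
  \<comment> \<open>The numerator after clearing denominators in the sum of v(a) / (T - a). At
    \<open>a\<^sub>0\<close> only one summand survives, so \<open>f\<close> is nonzero; evaluated at
    \<open>g\<close> it lies in \<open>M\<close>, because \<open>h a\<close> inverts
    \<open>g - mon_const a\<close> modulo \<open>M\<close>.\<close>
  define f where "f = (\<Sum>a\<in>A. smult (v a) (\<Prod>b\<in>A - {a}. [:- b, 1:]))"
  have "poly f a\<^sub>0 = (\<Sum>a\<in>A. if a = a\<^sub>0 then v a\<^sub>0 * (\<Prod>b\<in>A - {a\<^sub>0}. a\<^sub>0 - b) else 0)"
    unfolding f_def poly_sum
    using A(1) a\<^sub>0 by (intro sum.cong) (auto simp: poly_prod intro!: prod_zero)
  also have "\<dots> \<noteq> 0" using A(1) a\<^sub>0 by simp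
  finally have "f \<noteq> 0" by auto
  have hom_sum: "poly (map_poly mon_const (sum k I)) g = (\<Sum>i\<in>I. poly (map_poly mon_const (k i)) g)"
    for k :: "complex \<Rightarrow> complex poly" and I
    by (induction I rule: infinite_finite_induct) (simp_all add: map_poly_mon_const(1))
  have hom_prod: "poly (map_poly mon_const (\<Prod>b\<in>I. [:- b, 1:])) g = (\<Prod>b\<in>I. g - mon_const b)" for I
    by (induction I rule: infinite_finite_induct) (simp_all add: map_poly_mon_const(3) del: mult_pCons_left)
  let ?P = "\<lambda>a. \<Prod>b\<in>A - {a}. g - mon_const b"
  have "poly (map_poly mon_const f) g = (\<Sum>a\<in>A. mon_const (v a) * ?P a)"
    by (simp add: f_def hom_sum map_poly_mon_const(2) hom_prod)
  also have "\<dots> = (\<Sum>a\<in>A. mon_const (v a) * h a) * (\<Prod>b\<in>A. g - mon_const b)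
      - (\<Sum>a\<in>A. mon_const (v a) * ?P a * (h a * (g - mon_const a) - 1))"
  proof -
    have "mon_const (v a) * ?P a = mon_const (v a) * h a * (\<Prod>b\<in>A. g - mon_const b)
        - mon_const (v a) * ?P a * (h a * (g - mon_const a) - 1)" if "a \<in> A" for a
      using A(1) that by (subst prod.remove[of A a]) (auto simp: algebra_simps)
    then show ?thesis by (simp add: sum_distrib_right flip: sum_subtractf)
  qed
  also have "\<dots> \<in> M"
    unfolding dep by (rule minus_mem[OF _ sum_mem[OF left_mem[OF h]]]) (simp add: zero_mem)
  finally show False using root_mem[OF \<open>f \<noteq> 0\<close>] none by blast
qed

end

section \<open>Polynomial functions on affine space\<close>

lemma polyfun3_eq_0:
  fixes l :: "nat \<Rightarrow> nat \<Rightarrow> nat \<Rightarrow> complex"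
  assumes "\<And>a b c. (\<Sum>i\<le>d. (\<Sum>j\<le>d. (\<Sum>k\<le>d. l i j k * c ^ k) * b ^ j) * a ^ i) = 0"
    and "i \<le> d" "j \<le> d" "k \<le> d"
  shows "l i j k = 0"
proof -
  have 1: "\<forall>i\<le>d. (\<Sum>j\<le>d. (\<Sum>k\<le>d. l i j k * c ^ k) * b ^ j) = 0" for b c
    by (rule polyfun_eq_0[THEN iffD1]) (use assms(1) in blast)
  have 2: "\<forall>j\<le>d. (\<Sum>k\<le>d. l i j k * c ^ k) = 0" for c
    by (rule polyfun_eq_0[THEN iffD1]) (use 1 \<open>i \<le> d\<close> in blast)
  have "\<forall>k\<le>d. l i j k = 0"
    by (rule polyfun_eq_0[THEN iffD1]) (use 2 \<open>j \<le> d\<close> in blast)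
  then show ?thesis using \<open>k \<le> d\<close> by blast
qed

text \<open>Polymorphic, to serve both evaluation at complex points and substitution of
  \<open>px\<close>, \<open>py\<close>, \<open>pz\<close>.\<close>

fun mon_at :: "'a::ring_1 \<Rightarrow> 'a \<Rightarrow> 'a \<Rightarrow> nat \<times> nat \<times> nat \<Rightarrow> 'a" where
  "mon_at a b c (i, j, k) = a ^ i * b ^ j * c ^ k"

definition ev :: "complex \<Rightarrow> complex \<Rightarrow> complex \<Rightarrow> poly3 \<Rightarrow> complex" where
  "ev a b c = monoid_algebra_eval.eval (\<lambda>c. c) (mon_at a b c)"

interpretation ev: monoid_algebra_eval "\<lambda>c. c" "mon_at a b c"
  rewrites "monoid_algebra_eval.eval (\<lambda>c. c) (mon_at a b c) = ev a b c"
  for a b c :: complex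
proof -
  show "monoid_algebra_eval (\<lambda>c. c) (mon_at a b c)"
  proof
    show "mon_at a b c 0 = 1" by (simp add: zero_prod_def)
    show "mon_at a b c (m + n) = mon_at a b c m * mon_at a b c n" for m n
      by (cases m; cases n) (simp add: power_add algebra_simps)
  qed (simp_all add: mult.commute)
qed (simp add: ev_def)

lemma keys_box: "\<exists>d. Poly_Mapping.keys (p :: poly3) \<subseteq> {..d} \<times> {..d} \<times> {..d}"
proof -
  let ?K = "Poly_Mapping.keys p"
  define d where "d = Max (insert 0 (fst ` ?K \<union> (fst \<circ> snd) ` ?K \<union> (snd \<circ> snd) ` ?K))"
  have "n \<le> d" if "n \<in> fst ` ?K \<union> (fst \<circ> snd) ` ?K \<union> (snd \<circ> snd) ` ?K" for n
    unfolding d_def using that by (intro Max_ge) auto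
  then show ?thesis by (intro exI[of _ d]) force
qed

lemma ev_eq_0_imp_zero:
  assumes "\<And>a b c. ev a b c p = 0"
  shows "p = 0"
proof -
  obtain d where d: "Poly_Mapping.keys p \<subseteq> {..d} \<times> {..d} \<times> {..d}" using keys_box by blast
  let ?l = "\<lambda>i j k. Poly_Mapping.lookup p (i, j, k)"
  have "ev a b c p = (\<Sum>i\<le>d. (\<Sum>j\<le>d. (\<Sum>k\<le>d. ?l i j k * c ^ k) * b ^ j) * a ^ i)" for a b c
    by (subst ev.eval_superset[OF _ d])
       (simp_all add: sum_distrib_left sum.cartesian_product' mult_ac)
  then have l: "?l i j k = 0" if "i \<le> d" "j \<le> d" "k \<le> d" for i j k
    using polyfun3_eq_0[where l = ?l and d = d, OF _ that] assms by simp
  show ?thesis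
  proof (rule poly_mapping_eqI)
    fix m
    show "Poly_Mapping.lookup p m = Poly_Mapping.lookup 0 m"
    proof (cases "m \<in> Poly_Mapping.keys p")
      case True
      then obtain i j k where "m = (i, j, k)" "i \<le> d" "j \<le> d" "k \<le> d" using d by auto
      then show ?thesis using l by simp
    qed (simp add: in_keys_iff)
  qed
qed

section \<open>Transfer of prime ideals along isomorphisms\<close>

lemma ideal_ring_of_type_algebra:
  "ideal J (ring_of_type_algebra :: 'a::ring_1 ring) \<longleftrightarrow> two_sided J"
proof
  assume "ideal J (ring_of_type_algebra :: 'a ring)"
  then interpret ideal J "ring_of_type_algebra :: 'a ring" .
  show "two_sided J"
    using additive_subgroup.zero_closed[OF is_additive_subgroup]
      additive_subgroup.a_closed[OF is_additive_subgroup] I_l_closed I_r_closed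
    by (auto simp: two_sided_def)
next
  assume "two_sided J"
  then interpret two_sided_ideal J by unfold_locales
  interpret R: ring "ring_of_type_algebra :: 'a ring" by (rule ring_ring_of_type_algebra)
  show "ideal J (ring_of_type_algebra :: 'a ring)"
  proof (rule idealI)
    show "ring (ring_of_type_algebra :: 'a ring)" by (rule ring_ring_of_type_algebra)
    show "subgroup J (add_monoid (ring_of_type_algebra :: 'a ring))"
      by (rule R.add.subgroupI) (use zero_mem in \<open>auto intro: add_mem uminus_mem\<close>)
  qed (auto intro: left_mem right_mem)
qed

text \<open>The bridge between rings given by a type and rings given by a carrier. It is used from
  \<open>conif\<close> to \<open>Conifold\<close> and from \<open>poly3\<close> to
  \<open>Cxyz\<close>.\<close>

locale type_ring_iso =
  fixes h :: "'a::ring_1 \<Rightarrow> 'b" and S :: "'b ring"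
  assumes iso: "h \<in> ring_iso ring_of_type_algebra S" and ring: "ring S"
begin

lemma bij: "bij_betw h UNIV (carrier S)" and ring_hom: "h \<in> ring_hom ring_of_type_algebra S"
  using iso by (simp_all add: ring_iso_def)

lemma inj: "h a = h b \<longleftrightarrow> a = b"
  using bij_betw_imp_inj_on[OF bij] by (rule inj_eq)

lemma carrier: "carrier S = range h"
  using bij_betw_imp_surj_on[OF bij] by simp

lemma mem_image: "h a \<in> h ` J \<longleftrightarrow> a \<in> J"
  by (auto simp: inj)

lemma hom: "h (a + b) = h a \<oplus>\<^bsub>S\<^esub> h b" "h (a * b) = h a \<otimes>\<^bsub>S\<^esub> h b" "h 1 = \<one>\<^bsub>S\<^esub>"
  using ring_hom_add[OF ring_hom, of a b] ring_hom_mult[OF ring_hom, of a b] ring_hom_one[OF ring_hom]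
  by simp_all

lemma hom_zero: "h 0 = \<zero>\<^bsub>S\<^esub>"
  using ring_hom_zero[OF ring_hom ring_ring_of_type_algebra ring] by simp

lemma hom_minus: "h (a - b) = h a \<ominus>\<^bsub>S\<^esub> h b"
proof -
  interpret ring S by (rule ring)
  have closed: "h u \<in> carrier S" for u by (simp add: carrier)
  have "h (- b) \<oplus>\<^bsub>S\<^esub> h b = \<zero>\<^bsub>S\<^esub>"
    by (simp add: hom_zero flip: hom(1))
  then have "\<ominus>\<^bsub>S\<^esub> h b = h (- b)" by (simp add: closed minus_equality)
  then show ?thesis using hom(1)[of a "- b"] by (simp add: a_minus_def)
qed

lemma hom_pow: "h (a ^ n) = h a [^]\<^bsub>S\<^esub> (n::nat)"
proof -
  interpret ring S by (rule ring)
  show ?thesis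
  proof (induction n)
    case (Suc n)
    then show ?case unfolding power_Suc2 hom by simp
  qed (simp add: hom)
qed

lemma ideal_image: "ideal (h ` J) S \<longleftrightarrow> two_sided J"
proof
  assume "ideal (h ` J) S"
  moreover have "ring_hom_ring ring_of_type_algebra S h"
    by (rule ring_hom_ringI2[OF ring_ring_of_type_algebra ring ring_hom])
  ultimately have "ideal {r \<in> carrier ring_of_type_algebra. h r \<in> h ` J} ring_of_type_algebra"
    by (rule ring_hom_ring.ideal_vimage[rotated])
  then show "two_sided J" by (simp add: mem_image ideal_ring_of_type_algebra)
next
  assume J: "two_sided J"
  let ?g = "inv_into (carrier (ring_of_type_algebra :: 'a ring)) h"
  have g: "?g (h a) = a" for a
    using inj by (simp add: inv_f_f inj_def)
  have "?g \<in> ring_iso S ring_of_type_algebra"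
    by (rule ring_iso_set_sym[OF ring_ring_of_type_algebra iso])
  then have "ring_hom_ring S ring_of_type_algebra ?g"
    by (intro ring_hom_ringI2[OF ring ring_ring_of_type_algebra]) (simp add: ring_iso_def)
  then have "ideal {r \<in> carrier S. ?g r \<in> J} S"
    by (rule ring_hom_ring.ideal_vimage) (simp add: J ideal_ring_of_type_algebra)
  moreover have "{r \<in> carrier S. ?g r \<in> J} = h ` J"
    using g unfolding carrier by auto
  ultimately show "ideal (h ` J) S" by simp
qed

lemma ideal_is_image: "ideal I S \<Longrightarrow> I = h ` {a. h a \<in> I}"
  using ideal.Icarr[of I S] unfolding carrier by blast

lemma nc_primeideal_image: "nc_primeideal (h ` J) S \<longleftrightarrow> two_sided_prime J"
proof -
  have "h ` J \<noteq> carrier S \<longleftrightarrow> 1 \<notin> J" if "two_sided J"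
  proof -
    interpret two_sided_ideal J using that by unfold_locales
    have "1 \<in> J \<Longrightarrow> a \<in> J" for a using left_mem[of 1 a] by simp
    then have "1 \<in> J \<longleftrightarrow> J = UNIV" by blast
    moreover have "h ` J = carrier S \<longleftrightarrow> J = UNIV"
      unfolding carrier by (rule inj_image_eq_iff) (simp add: inj_def inj)
    ultimately show ?thesis by blast
  qed
  moreover have "(\<forall>a\<in>carrier S. \<forall>b\<in>carrier S. (\<forall>r\<in>carrier S. a \<otimes>\<^bsub>S\<^esub> r \<otimes>\<^bsub>S\<^esub> b \<in> h ` J) \<longrightarrow> a \<in> h ` J \<or> b \<in> h ` J)
      \<longleftrightarrow> (\<forall>a b. (\<forall>r. a * r * b \<in> J) \<longrightarrow> a \<in> J \<or> b \<in> J)"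
    unfolding carrier by (simp add: mem_image flip: hom(2))
  ultimately show ?thesis
    unfolding nc_primeideal_def two_sided_prime_def ideal_image by blast
qed

lemma nc_spec_eq: "nc_spec S = (`) h ` {J. two_sided_prime J}"
proof (intro equalityI subsetI)
  fix P assume P: "P \<in> nc_spec S"
  then have "P = h ` {a. h a \<in> P}"
    by (intro ideal_is_image) (simp add: nc_spec_def nc_primeideal_def)
  moreover from this have "two_sided_prime {a. h a \<in> P}"
    using P nc_primeideal_image[of "{a. h a \<in> P}"] by (simp add: nc_spec_def)
  ultimately show "P \<in> (`) h ` {J. two_sided_prime J}" by blast
qed (auto simp: nc_spec_def nc_primeideal_image)

end

lemma Rep_conif_iso: "Rep_conif \<in> ring_iso ring_of_type_algebra Conifold"
proof (rule ring_iso_memI)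
  have "range Rep_conif = carrier Conifold"
    by (metis type_definition.Rep_range type_definition_conif)
  then show "bij_betw Rep_conif (carrier ring_of_type_algebra) (carrier Conifold)"
    by (simp add: bij_betw_def inj_def Rep_conif_inject)
qed (simp_all add: Rep_conif_ops)

interpretation Rep: type_ring_iso Rep_conif Conifold
  by unfold_locales (rule Rep_conif_iso ring_Conifold)+

section \<open>Substituting the central elements into polynomials\<close>

lemma power_central:
  fixes u :: "'a::monoid_mult"
  assumes "\<And>a. u * a = a * u"
  shows "u ^ n * a = a * u ^ n"
  by (rule power_commuting_commutes) (rule assms)

definition peval :: "poly3 \<Rightarrow> conif" where
  "peval = monoid_algebra_eval.eval sc (mon_at px py pz)"

lemma mon_at_central: "mon_at px py pz m * a = a * mon_at px py pz m"
proof (cases m)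
  case (fields i j k)
  show ?thesis
    unfolding fields mon_at.simps
    using power_central[OF px_central, of i a] power_central[OF py_central, of j a]
      power_central[OF pz_central, of k a]
    by (metis mult.assoc)
qed

interpretation peval: monoid_algebra_eval sc "mon_at px py pz"
  rewrites "monoid_algebra_eval.eval sc (mon_at px py pz) = peval"
proof -
  show "monoid_algebra_eval sc (mon_at px py pz)"
  proof
    show "mon_at px py pz 0 = 1" by (simp add: zero_prod_def)
    show "mon_at px py pz (m + n) = mon_at px py pz m * mon_at px py pz n" for m n
    proof (cases m; cases n)
      fix i j k i' j' k'
      assume m: "m = (i, j, k)" and n: "n = (i', j', k')"
      have x: "px ^ i' * a = a * px ^ i'" for a by (rule power_central[OF px_central])
      have y: "py ^ j' * a = a * py ^ j'" for a by (rule power_central[OF py_central])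
      have "mon_at px py pz (m + n) = px ^ i * (px ^ i' * (py ^ j * (py ^ j' * pz ^ k))) * pz ^ k'"
        by (simp add: m n power_add mult.assoc)
      also have "\<dots> = px ^ i * (py ^ j * pz ^ k * py ^ j') * px ^ i' * pz ^ k'"
        unfolding y x by (simp add: mult.assoc)
      also have "\<dots> = px ^ i * (py ^ j * pz ^ k) * (py ^ j' * px ^ i') * pz ^ k'"
        by (simp add: mult.assoc)
      also have "\<dots> = mon_at px py pz m * mon_at px py pz n"
        unfolding y by (simp add: m n mult.assoc)
      finally show ?thesis .
    qed
  qed (simp_all add: sc_add sc_mult mon_at_central)
qed (simp add: peval_def)

lemma peval_central: "peval p * a = a * peval p"
proof (induction p rule: poly_mapping_single_induct)
  case (single m c p)
  have "sc c * mon_at px py pz m * a = a * (sc c * mon_at px py pz m)"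
    by (metis mon_at_central mult.assoc sc_commute)
  then show ?case using single by (simp add: peval.eval_add distrib_left distrib_right)
qed simp

definition pvar :: "nat \<times> nat \<times> nat \<Rightarrow> poly3" where
  "pvar m = Poly_Mapping.single m 1"

lemma peval_pvar: "peval (pvar (1, 0, 0)) = px" "peval (pvar (0, 1, 0)) = py" "peval (pvar (0, 0, 1)) = pz"
  by (simp_all add: pvar_def)

lemma ev_pvar: "ev a b c (pvar (1, 0, 0)) = a" "ev a b c (pvar (0, 1, 0)) = b" "ev a b c (pvar (0, 0, 1)) = c"
  by (simp_all add: pvar_def)

lemma peval_const: "peval (mon_const c) = sc c"
  by (simp add: zero_prod_def)

lemma ev_const: "ev a b c (mon_const d) = d"
  by (simp add: zero_prod_def)

lemma sc_power: "sc (c ^ n) = sc c ^ n"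
  by (induction n) (simp_all add: sc_mult)

lemma (in conif_ideal) peval_cong:
  assumes "lies_above Q a b c"
  shows "peval p \<approx> sc (ev a b c p)"
proof (induction p rule: poly_mapping_single_induct)
  case (single m d p)
  have p: "px \<approx> sc a" "py \<approx> sc b" "pz \<approx> sc c"
    using assms by (simp_all add: lies_above_def cong_def)
  obtain i j k where m: "m = (i, j, k)" by (cases m)
  have "sc d * (px ^ i * py ^ j * pz ^ k) \<approx> sc d * (sc a ^ i * sc b ^ j * sc c ^ k)"
    by (intro cong_mult cong_power cong_refl p)
  also have "\<dots> = sc (d * mon_at a b c m)" by (simp add: m sc_mult sc_power)
  finally show ?case
    using single by (simp add: peval.eval_add ev.eval_add sc_add cong_add m)
qed simp

lemma pvar_power: "pvar (1, 0, 0) ^ i = pvar (i, 0, 0)" "pvar (0, 1, 0) ^ i = pvar (0, i, 0)"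
  "pvar (0, 0, 1) ^ i = pvar (0, 0, i)"
  by (induction i) (simp_all add: pvar_def mult_single flip: single_one zero_prod_def)

lemma single_eq_pvar:
  "Poly_Mapping.single (i, j, k) d =
    mon_const d * (pvar (1, 0, 0) ^ i * pvar (0, 1, 0) ^ j * pvar (0, 0, 1) ^ k)"
  unfolding pvar_power by (simp add: pvar_def mult_single)

locale poly3_ideal = two_sided_ideal Q for Q :: "poly3 set"
begin

text \<open>Reduces an ideal that contains the three coordinate differences to its constants. This
  identifies maximal ideals with points and shows that the variables generate the ideal of the
  origin.\<close>

lemma poly_cong:
  assumes v: "pvar (1, 0, 0) \<approx> mon_const a" "pvar (0, 1, 0) \<approx> mon_const b" "pvar (0, 0, 1) \<approx> mon_const c"
  shows "p \<approx> mon_const (ev a b c p)"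
proof (induction p rule: poly_mapping_single_induct)
  case (single m d p)
  obtain i j k where m: "m = (i, j, k)" by (cases m)
  have const_power: "mon_const x ^ n = (mon_const (x ^ n) :: poly3)" for x n
    by (induction n) (simp_all add: mult_single)
  have "Poly_Mapping.single m d
      \<approx> mon_const d * (mon_const a ^ i * mon_const b ^ j * mon_const c ^ k)"
    unfolding m single_eq_pvar by (intro cong_mult cong_power cong_refl v)
  also have "\<dots> = mon_const (d * mon_at a b c m)" by (simp add: m mult_single const_power)
  finally show ?case
    using single by (simp add: ev.eval_add single_add cong_add m)
qed simp

end

section \<open>The map to affine space\<close>

lemma Rep_gens: "Rep_conif gX = cX" "Rep_conif gY = cY" "Rep_conif (sc c) = cscalar c"
  by (simp_all add: gX_def gY_def sc_def cX_def cY_def cscalar_def Rep_conif_of)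

lemma Rep_p: "Rep_conif px = cx" "Rep_conif py = cy" "Rep_conif pz = cz"
  by (simp_all add: px_def py_def pz_def cx_def cy_def cz_def Rep_gens Rep_conif_ops
      flip: power2_eq_square) (simp_all add: Rep.hom_pow Rep_gens)

lemma Rep_sum: "finsum Conifold (\<lambda>i. Rep_conif (g i)) A = Rep_conif (sum g A)"
  by (induction A rule: infinite_finite_induct) (simp_all add: Rep_conif_ops Pi_def)

lemma eval_xyz_eq: "eval_xyz p = Rep_conif (peval p)"
proof -
  have "(\<lambda>(i, j, k). cscalar (Poly_Mapping.lookup p (i, j, k)) \<otimes>\<^bsub>Conifold\<^esub>
      (cx [^]\<^bsub>Conifold\<^esub> i \<otimes>\<^bsub>Conifold\<^esub> cy [^]\<^bsub>Conifold\<^esub> j \<otimes>\<^bsub>Conifold\<^esub> cz [^]\<^bsub>Conifold\<^esub> k))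
    = (\<lambda>m. Rep_conif (sc (Poly_Mapping.lookup p m) * mon_at px py pz m))"
    by (rule ext) (simp add: Rep_conif_ops Rep.hom_pow Rep_gens Rep_p split: prod.split)
  then show ?thesis
    unfolding eval_xyz_def by (simp only: Rep_sum peval.eval_def)
qed

lemma eval_xyz_in_carrier: "eval_xyz p \<in> carrier Cxyz"
proof -
  let ?H = "generate_ring Conifold (range cscalar \<union> {cx, cy, cz})"
  have scalar: "Rep_conif (sc c) \<in> ?H" for c
    by (rule generate_ring.incl) (simp add: Rep_gens)
  have gens: "Rep_conif px \<in> ?H" "Rep_conif py \<in> ?H" "Rep_conif pz \<in> ?H"
    by (rule generate_ring.incl, simp add: Rep_p)+
  have mult: "Rep_conif (u * v) \<in> ?H" if "Rep_conif u \<in> ?H" "Rep_conif v \<in> ?H" for u v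
    using generate_ring.eng_mult[OF that] by (simp add: Rep_conif_ops)
  have power: "Rep_conif (u ^ n) \<in> ?H" if "Rep_conif u \<in> ?H" for u n
    by (induction n) (use scalar[of 1] mult[OF that] in simp_all)
  have "Rep_conif (peval p) \<in> ?H"
  proof (induction p rule: poly_mapping_single_induct)
    case zero
    show ?case using scalar[of 0] by simp
  next
    case (single m c p)
    obtain i j k where m: "m = (i, j, k)" by (cases m)
    have "Rep_conif (sc c * mon_at px py pz m) \<in> ?H"
      unfolding m mon_at.simps by (intro mult scalar power gens)
    then show ?case using single generate_ring.eng_add
      by (simp add: peval.eval_add Rep_conif_ops(3))
  qed
  then show ?thesis by (simp add: Cxyz_def eval_xyz_eq)
qed

lemma carrier_Cxyz: "carrier Cxyz = range eval_xyz"
proof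
  show "range eval_xyz \<subseteq> carrier Cxyz" using eval_xyz_in_carrier by blast
  have "A \<in> range eval_xyz" if "A \<in> generate_ring Conifold (range cscalar \<union> {cx, cy, cz})" for A
    using that
  proof induction
    case one
    show ?case using peval.eval_one by (metis Rep_conif_ops(2) eval_xyz_eq rangeI)
  next
    case (incl A)
    then show ?case using peval_const peval_pvar
      by (metis (no_types, lifting) Rep_gens(3) Rep_p UnE empty_iff eval_xyz_eq imageE insertE rangeI)
  next
    case (a_inv A)
    then obtain p where "A = Rep_conif (peval p)" by (auto simp: eval_xyz_eq)
    then have "\<ominus>\<^bsub>Conifold\<^esub> A = eval_xyz (- p)"
      using peval.eval_minus[of 0 p] by (simp add: eval_xyz_eq Rep_conif_ops(5))
    then show ?case by blast
  next
    case (eng_add A B)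
    then obtain p q where "A = eval_xyz p" "B = eval_xyz q" by blast
    then have "A \<oplus>\<^bsub>Conifold\<^esub> B = eval_xyz (p + q)"
      by (simp add: eval_xyz_eq peval.eval_add Rep_conif_ops(3))
    then show ?case by blast
  next
    case (eng_mult A B)
    then obtain p q where "A = eval_xyz p" "B = eval_xyz q" by blast
    then have "A \<otimes>\<^bsub>Conifold\<^esub> B = eval_xyz (p * q)"
      by (simp add: eval_xyz_eq peval.eval_mult Rep_conif_ops(6))
    then show ?case by blast
  qed
  then show "carrier Cxyz \<subseteq> range eval_xyz" by (auto simp: Cxyz_def)
qed

lemma Cxyz_ops [simp]:
  "A \<otimes>\<^bsub>Cxyz\<^esub> B = A \<otimes>\<^bsub>Conifold\<^esub> B" "A \<oplus>\<^bsub>Cxyz\<^esub> B = A \<oplus>\<^bsub>Conifold\<^esub> B"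
  "\<one>\<^bsub>Cxyz\<^esub> = \<one>\<^bsub>Conifold\<^esub>"
  by (simp_all add: Cxyz_def)

text \<open>A consequence of the counts, which are never zero; it brings the representations into
  the proof of algebraic independence.\<close>

lemma exists_prime_above: "\<exists>Q. two_sided_prime Q \<and> lies_above Q a b c"
proof -
  have "card {Q. two_sided_prime Q \<and> lies_above Q a b c} \<noteq> 0"
    using primes_above_nonzero_card[of a b c] primes_above_zero_card by (cases "(a, b, c) = (0, 0, 0)") auto
  then have "{Q. two_sided_prime Q \<and> lies_above Q a b c} \<noteq> {}" by (metis card.empty)
  then show ?thesis by blast
qed

text \<open>Modulo \<open>Q\<close> a polynomial in the central elements is its value at the point,
  and a proper ideal contains no nonzero scalar. Backwards, apply the equality to each variable
  minus its coordinate.\<close>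

lemma prime_peval_mem:
  assumes Q: "two_sided_prime Q"
  shows "lies_above Q a b c \<longleftrightarrow> {p. peval p \<in> Q} = {p. ev a b c p = 0}"
proof
  assume above: "lies_above Q a b c"
  interpret conif_ideal Q using Q by unfold_locales (simp add: two_sided_prime_def)
  have "d = 0" if "sc d \<in> Q" for d
    using left_mem[OF that, of "sc (inverse d)"] Q
    by (cases "d = 0") (simp_all add: two_sided_prime_def flip: sc_mult)
  moreover have "sc 0 \<in> Q" using zero_mem by simp
  ultimately show "{p. peval p \<in> Q} = {p. ev a b c p = 0}"
    using cong_mem[OF peval_cong[OF above]] by fastforce
next
  assume eq: "{p. peval p \<in> Q} = {p. ev a b c p = 0}"
  have "ev a b c (v - mon_const d) = 0 \<Longrightarrow> peval v - sc d \<in> Q" for v d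
    using eq by (metis (mono_tags) mem_Collect_eq peval.eval_minus peval_const)
  from this[of "pvar (1, 0, 0)" a] this[of "pvar (0, 1, 0)" b] this[of "pvar (0, 0, 1)" c]
  show "lies_above Q a b c"
    by (simp only: lies_above_def peval_pvar ev.eval_minus ev_pvar ev_const diff_self simp_thms)
qed

text \<open>If the difference is sent to 0, it lies in the contraction of a prime above every point,
  hence vanishes as a function on affine space.\<close>

lemma peval_inj: "peval p = peval q \<longleftrightarrow> p = q"
proof
  assume "peval p = peval q"
  then have "peval (p - q) = 0" by (simp add: peval.eval_minus)
  then have "ev a b c (p - q) = 0" for a b c
  proof -
    obtain Q where Q: "two_sided_prime Q" "lies_above Q a b c" using exists_prime_above by blast
    then have "peval (p - q) \<in> Q"
      using \<open>peval (p - q) = 0\<close> by (simp add: two_sided_prime_def two_sided_def)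
    then show ?thesis using prime_peval_mem[OF Q(1)] Q(2) by blast
  qed
  then show "p = q" using ev_eq_0_imp_zero by fastforce
qed simp

lemma eval_xyz_iso: "eval_xyz \<in> ring_iso ring_of_type_algebra Cxyz"
proof (rule ring_iso_memI)
  show "bij_betw eval_xyz (carrier ring_of_type_algebra) (carrier Cxyz)"
    by (simp add: bij_betw_def carrier_Cxyz inj_def eval_xyz_eq Rep_conif_inject peval_inj)
qed (simp_all add: eval_xyz_eq carrier_Cxyz peval.eval_add peval.eval_mult peval.eval_one Rep_conif_ops)

interpretation eval_xyz: type_ring_iso eval_xyz Cxyz
  by (rule type_ring_iso.intro[OF eval_xyz_iso ring_Cxyz])

lemma restrict_xyz_Rep: "restrict_xyz (Rep_conif ` Q) = eval_xyz ` {p. peval p \<in> Q}"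
  unfolding restrict_xyz_def carrier_Cxyz by (auto simp: eval_xyz_eq Rep_conif_inject)

text \<open>As \<open>peval p\<close> is central, membership of the product with
  \<open>peval q\<close> already gives the full condition with an arbitrary \<open>r\<close> in
  between.\<close>

lemma contraction_prime:
  assumes Q: "two_sided_prime Q"
  shows "two_sided_prime {p. peval p \<in> Q}"
proof -
  interpret two_sided_ideal Q using Q by unfold_locales (simp add: two_sided_prime_def)
  have "peval p \<in> Q \<or> peval q \<in> Q" if "\<forall>r. peval (p * r * q) \<in> Q" for p q
  proof -
    have "peval p * peval q \<in> Q"
      using that[rule_format, of 1] by (simp add: peval.eval_mult)
    then have "peval p * r * peval q \<in> Q" for r
      using left_mem[of "peval p * peval q" r] by (metis mult.assoc peval_central)
    then show ?thesis using Q by (auto simp: two_sided_prime_def)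
  qed
  then show ?thesis
    using Q by (auto simp: two_sided_prime_def two_sided_def peval.eval_add peval.eval_mult peval.eval_one)
qed

text \<open>The preimage of the open set of \<open>I\<close> is the open set of the ideal that
  \<open>I\<close> generates in the whole algebra.\<close>

lemma continuous_restrict_xyz: "continuous_map (zariski Conifold) (zariski Cxyz) restrict_xyz"
proof -
  have spec: "restrict_xyz P \<in> nc_spec Cxyz" if "P \<in> nc_spec Conifold" for P
    using that contraction_prime unfolding Rep.nc_spec_eq eval_xyz.nc_spec_eq
    by (auto simp: restrict_xyz_Rep)
  show ?thesis
    unfolding continuous_map_def ring.topspace_zariski[OF ring_Conifold]
      ring.topspace_zariski[OF ring_Cxyz] ring.openin_zariski[OF ring_Conifold]
      ring.openin_zariski[OF ring_Cxyz]
  proof (intro conjI allI impI)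
    show "restrict_xyz \<in> nc_spec Conifold \<rightarrow> nc_spec Cxyz" using spec by blast
    fix U assume "\<exists>I. ideal I Cxyz \<and> U = zariski_open Cxyz I"
    then obtain I where I: "ideal I Cxyz" "U = zariski_open Cxyz I" by blast
    have IC: "I \<subseteq> carrier Cxyz" using ideal.Icarr[OF I(1)] by blast
    then have IL: "I \<subseteq> carrier Conifold" by (auto simp: carrier_Cxyz eval_xyz_eq)
    let ?J = "genideal Conifold I"
    have "I \<subseteq> restrict_xyz P \<longleftrightarrow> ?J \<subseteq> P" if "P \<in> nc_spec Conifold" for P
    proof -
      have "ideal P Conifold" using that by (simp add: nc_spec_def nc_primeideal_def)
      then show ?thesis
        using Conifold.genideal_minimal[of P I] Conifold.genideal_self[OF IL] IC
        unfolding restrict_xyz_def by blast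
    qed
    then have "{P \<in> nc_spec Conifold. restrict_xyz P \<in> U} = zariski_open Conifold ?J"
      using spec unfolding I(2) zariski_open_def by blast
    then show "\<exists>J. ideal J Conifold \<and> {P \<in> nc_spec Conifold. restrict_xyz P \<in> U} = zariski_open Conifold J"
      using Conifold.genideal_ideal[OF IL] by blast
  qed
qed

lemma maximalideal_point:
  assumes max: "maximalideal \<nn> Cxyz"
  obtains a b c where "\<nn> = eval_xyz ` {p. ev a b c p = 0}"
proof -
  interpret max: maximalideal \<nn> Cxyz by (rule max)
  define M where "M = {p. eval_xyz p \<in> \<nn>}"
  have \<nn>: "\<nn> = eval_xyz ` M"
    unfolding M_def by (rule eval_xyz.ideal_is_image[OF max.is_ideal])
  have M: "two_sided M"
    using max.is_ideal unfolding \<nn> eval_xyz.ideal_image .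
  have proper: "M \<noteq> UNIV" using max.I_notcarr unfolding \<nn> carrier_Cxyz by blast
  interpret poly3_ideal M by unfold_locales (rule M)
  have one: "1 \<notin> M"
    using proper left_mem[of 1] by auto
  interpret maximal_poly_ideal M
  proof
    show "1 \<notin> M" by (rule one)
    fix p assume "p \<notin> M"
    \<comment> \<open>The ideal generated by \<open>M\<close> and \<open>p\<close>. By maximality it
      is everything, and writing 1 in this form exhibits the inverse of \<open>p\<close> modulo
      \<open>M\<close>.\<close>
    let ?J = "{q * p + r |q r. r \<in> M}"
    have J: "q * p + r \<in> ?J" if "r \<in> M" for q r using that by blast
    have "two_sided ?J"
      unfolding two_sided_def
    proof (intro conjI ballI allI)
      show "0 \<in> ?J" using J[OF zero_mem, of 0] by simp
      show "u + v \<in> ?J" if u: "u \<in> ?J" and v: "v \<in> ?J" for u v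
      proof -
        obtain q r where "u = q * p + r" "r \<in> M" using u by blast
        moreover obtain q' r' where "v = q' * p + r'" "r' \<in> M" using v by blast
        ultimately show ?thesis using J[of "r + r'" "q + q'"] add_mem by (simp add: algebra_simps)
      qed
      show scale: "s * u \<in> ?J" if u: "u \<in> ?J" for u s
      proof -
        obtain q r where "u = q * p + r" "r \<in> M" using u by blast
        then show ?thesis using J[of "s * r" "s * q"] left_mem by (simp add: algebra_simps)
      qed
      show "u * s \<in> ?J" if "u \<in> ?J" for u s using scale[OF that, of s] by (simp only: mult.commute)
    qed
    then have "ideal (eval_xyz ` ?J) Cxyz" by (simp only: eval_xyz.ideal_image)
    moreover have "\<nn> \<subseteq> eval_xyz ` ?J" unfolding \<nn> using J[of _ 0] by (intro image_mono) auto
    moreover have "eval_xyz ` ?J \<subseteq> carrier Cxyz" unfolding carrier_Cxyz by blast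
    ultimately have "eval_xyz ` ?J = \<nn> \<or> eval_xyz ` ?J = carrier Cxyz" by (rule max.I_maximal)
    moreover have "p \<in> ?J" using J[OF zero_mem, of 1] by simp
    then have "eval_xyz p \<in> eval_xyz ` ?J" by (rule imageI)
    moreover have "eval_xyz p \<notin> \<nn>" using \<open>p \<notin> M\<close> by (simp add: M_def)
    ultimately have "eval_xyz 1 \<in> eval_xyz ` ?J" unfolding carrier_Cxyz by blast
    then have "1 \<in> ?J" by (rule eval_xyz.mem_image[THEN iffD1])
    then obtain q r where "1 = q * p + r" "r \<in> M" by blast
    then have "q * p - 1 = - r" by (simp add: algebra_simps)
    then show "\<exists>q. q * p - 1 \<in> M" using uminus_mem[OF \<open>r \<in> M\<close>] by metis
  qed
  \<comment> \<open>The cubes of exponents are countably many finite sets, and every polynomial has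
    its exponents in one of them.\<close>
  have root: "\<exists>a. g - mon_const a \<in> M" for g
    by (rule nullstellensatz[where B = "\<lambda>d. {..d} \<times> {..d} \<times> {..d}"]) (use keys_box in auto)
  obtain a b c where v: "pvar (1, 0, 0) - mon_const a \<in> M" "pvar (0, 1, 0) - mon_const b \<in> M"
      "pvar (0, 0, 1) - mon_const c \<in> M"
    using root by metis
  have "p \<in> M \<longleftrightarrow> ev a b c p = 0" for p
    using cong_mem[OF poly_cong[OF v[folded cong_def]], of p] const_mem zero_mem by fastforce
  then have "M = {p. ev a b c p = 0}" by blast
  then show thesis using that \<nn> by blast
qed

text \<open>Both isomorphisms are injective on sets as well, so the fibre can be counted among
  subsets of \<open>conif\<close>.\<close>

lemma restrict_fibre_point:
  "card (restrict_fibre (eval_xyz ` {p. ev a b c p = 0})) = card {Q. two_sided_prime Q \<and> lies_above Q a b c}"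
proof -
  have "restrict_xyz (Rep_conif ` Q) = eval_xyz ` {p. ev a b c p = 0} \<longleftrightarrow> lies_above Q a b c"
    if "two_sided_prime Q" for Q
    unfolding restrict_xyz_Rep prime_peval_mem[OF that]
    by (rule inj_image_eq_iff) (simp add: inj_def eval_xyz.inj)
  then have "restrict_fibre (eval_xyz ` {p. ev a b c p = 0})
      = (`) Rep_conif ` {Q. two_sided_prime Q \<and> lies_above Q a b c}"
    unfolding restrict_fibre_def Rep.nc_spec_eq by blast
  moreover have "inj_on ((`) Rep_conif) S" for S
    by (rule inj_on_image) (simp add: inj_on_def Rep_conif_inject)
  ultimately show ?thesis by (simp add: card_image)
qed

lemma ev_kernel_prime: "two_sided_prime {p. ev a b c p = 0}"
proof -
  obtain Q where "two_sided_prime Q" "lies_above Q a b c" using exists_prime_above by blast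
  then show ?thesis using contraction_prime prime_peval_mem by metis
qed

lemma eval_xyz_pvar: "eval_xyz (pvar (1, 0, 0)) = cx" "eval_xyz (pvar (0, 1, 0)) = cy"
  "eval_xyz (pvar (0, 0, 1)) = cz"
  unfolding eval_xyz_eq peval_pvar Rep_p by (rule refl)+

lemma point_in_quadric:
  "eval_xyz ` {p. ev a b c p = 0}
    \<in> zariski_closed Cxyz (cx \<otimes>\<^bsub>Cxyz\<^esub> cy \<ominus>\<^bsub>Cxyz\<^esub> cz [^]\<^bsub>Cxyz\<^esub> (2::nat)) \<longleftrightarrow> a * b = c * c"
proof -
  let ?f = "pvar (1, 0, 0) * pvar (0, 1, 0) - pvar (0, 0, 1) ^ 2"
  have f: "cx \<otimes>\<^bsub>Cxyz\<^esub> cy \<ominus>\<^bsub>Cxyz\<^esub> cz [^]\<^bsub>Cxyz\<^esub> (2::nat) = eval_xyz ?f"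
    unfolding eval_xyz.hom_minus eval_xyz.hom(2) eval_xyz.hom_pow eval_xyz_pvar by (rule refl)
  have "eval_xyz ` {p. ev a b c p = 0} \<in> nc_spec Cxyz"
    using ev_kernel_prime unfolding eval_xyz.nc_spec_eq by blast
  moreover have "ev a b c ?f = a * b - c * c"
    unfolding power2_eq_square ev.eval_minus ev.eval_mult ev_pvar ..
  ultimately show ?thesis
    unfolding zariski_closed_def f by (simp add: eval_xyz.mem_image)
qed

lemma origin_ideal:
  "Idl\<^bsub>Cxyz\<^esub> {cx, cy, cz} = eval_xyz ` {p. ev 0 0 0 p = 0}"
proof -
  interpret ring Cxyz by (rule ring_Cxyz)
  have gens: "{cx, cy, cz} \<subseteq> carrier Cxyz"
    unfolding carrier_Cxyz using eval_xyz_pvar by (metis empty_subsetI insert_subset rangeI)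
  define M where "M = {p. eval_xyz p \<in> Idl\<^bsub>Cxyz\<^esub> {cx, cy, cz}}"
  have Idl: "Idl\<^bsub>Cxyz\<^esub> {cx, cy, cz} = eval_xyz ` M"
    unfolding M_def by (rule eval_xyz.ideal_is_image[OF genideal_ideal[OF gens]])
  have "two_sided M"
    using genideal_ideal[OF gens] unfolding Idl eval_xyz.ideal_image .
  then interpret M: poly3_ideal M by unfold_locales
  have v: "pvar (1, 0, 0) \<in> M" "pvar (0, 1, 0) \<in> M" "pvar (0, 0, 1) \<in> M"
    using genideal_self[OF gens] by (simp_all only: M_def mem_Collect_eq eval_xyz_pvar) auto
  have "p \<in> M" if "ev 0 0 0 p = 0" for p
    using M.poly_cong[of 0 0 0 p] v that by (simp add: M.cong_def)
  then have "eval_xyz ` {p. ev 0 0 0 p = 0} \<subseteq> Idl\<^bsub>Cxyz\<^esub> {cx, cy, cz}"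
    unfolding Idl by blast
  moreover have "Idl\<^bsub>Cxyz\<^esub> {cx, cy, cz} \<subseteq> eval_xyz ` {p. ev 0 0 0 p = 0}"
  proof (rule genideal_minimal)
    show "ideal (eval_xyz ` {p. ev 0 0 0 p = 0}) Cxyz"
      using ev_kernel_prime unfolding eval_xyz.ideal_image two_sided_prime_def by blast
    show "{cx, cy, cz} \<subseteq> eval_xyz ` {p. ev 0 0 0 p = 0}"
      using ev_pvar[of 0 0 0] unfolding eval_xyz_pvar[symmetric] by blast
  qed
  ultimately show ?thesis by blast
qed

lemma point_eq_origin:
  "eval_xyz ` {p. ev a b c p = 0} = Idl\<^bsub>Cxyz\<^esub> {cx, cy, cz} \<longleftrightarrow> (a, b, c) = (0, 0, 0)"
proof
  assume "eval_xyz ` {p. ev a b c p = 0} = Idl\<^bsub>Cxyz\<^esub> {cx, cy, cz}"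
  then have "{p. ev a b c p = 0} = {p. ev 0 0 0 p = 0}"
    unfolding origin_ideal by (subst (asm) inj_image_eq_iff) (simp_all add: inj_def eval_xyz.inj)
  then show "(a, b, c) = (0, 0, 0)"
    using ev_pvar[of a b c] ev_pvar[of 0 0 0] by (metis (mono_tags) mem_Collect_eq)
qed (simp add: origin_ideal)

text \<open>Centrality and the isomorphism with the polynomial ring are what allow the target of the
  restriction map to be read as affine space.\<close>

theorem lemma5p5:
  shows
    "(\<forall>a\<in>carrier Cxyz. \<forall>b\<in>carrier Conifold. a \<otimes>\<^bsub>Conifold\<^esub> b = b \<otimes>\<^bsub>Conifold\<^esub> a)
     \<and> eval_xyz \<in> ring_iso (ring_of_type_algebra :: poly3 ring) Cxyz
     \<and> continuous_map (zariski Conifold) (zariski Cxyz) restrict_xyz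
     \<and> (\<forall>\<nn>. maximalideal \<nn> Cxyz \<longrightarrow>
          (let V = zariski_closed Cxyz (cx \<otimes>\<^bsub>Cxyz\<^esub> cy \<ominus>\<^bsub>Cxyz\<^esub> cz [^]\<^bsub>Cxyz\<^esub> (2::nat));
               \<oo> = Idl\<^bsub>Cxyz\<^esub> {cx, cy, cz}
           in (\<nn> \<notin> V \<longrightarrow> card (restrict_fibre \<nn>) = 2)
            \<and> (\<nn> \<noteq> \<oo> \<and> \<nn> \<in> V \<longrightarrow> card (restrict_fibre \<nn>) = 1)
            \<and> (\<nn> = \<oo> \<longrightarrow> card (restrict_fibre \<nn>) = 2)))"
proof (intro conjI ballI allI impI)
  fix A B assume "A \<in> carrier Cxyz" "B \<in> carrier Conifold"
  then obtain p b where "A = Rep_conif (peval p)" "B = Rep_conif b"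
    unfolding carrier_Cxyz Rep.carrier eval_xyz_eq by blast
  then show "A \<otimes>\<^bsub>Conifold\<^esub> B = B \<otimes>\<^bsub>Conifold\<^esub> A"
    by (simp add: peval_central flip: Rep_conif_ops(6))
next
  fix \<nn> assume "maximalideal \<nn> Cxyz"
  then obtain a b c where \<nn>: "\<nn> = eval_xyz ` {p. ev a b c p = 0}" by (rule maximalideal_point)
  show "let V = zariski_closed Cxyz (cx \<otimes>\<^bsub>Cxyz\<^esub> cy \<ominus>\<^bsub>Cxyz\<^esub> cz [^]\<^bsub>Cxyz\<^esub> (2::nat));
               \<oo> = Idl\<^bsub>Cxyz\<^esub> {cx, cy, cz}
           in (\<nn> \<notin> V \<longrightarrow> card (restrict_fibre \<nn>) = 2)
            \<and> (\<nn> \<noteq> \<oo> \<and> \<nn> \<in> V \<longrightarrow> card (restrict_fibre \<nn>) = 1)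
            \<and> (\<nn> = \<oo> \<longrightarrow> card (restrict_fibre \<nn>) = 2)"
    unfolding Let_def \<nn> restrict_fibre_point point_in_quadric point_eq_origin
    using primes_above_nonzero_card[of a b c] primes_above_zero_card
    by (cases "(a, b, c) = (0, 0, 0)") auto
qed (rule eval_xyz_iso continuous_restrict_xyz)+

end
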